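(* A cartesian double factorization system $(\mathcal{E},\mathcal{J},\mathcal{M})$ on a topos $\mathcal{C}$ generates a Lawvere–Tierney topology $k$ on $\mathcal{C}$ and is a Bousfield localization of the double factorization system $(\mathrm{Epi},\mathrm{DnsMono}_k,\mathrm{ClsMono}_k)$.
   Context: Topos means elementary topos, with subobject classifier $\mathrm{true}\colon 1\rightarrowtail\Omega$. For classes of morphisms, $\mathcal{B}\cdot\mathcal{A}$ is the class of composites $ba$ with $a\in\mathcal{A}$, $b\in\mathcal{B}$. $\mathrm{Iso}$, $\mathrm{Epi}$, $\mathrm{Mono}$ are the classes of all isomorphisms, epimorphisms and monomorphisms of $\mathcal{C}$. "Generates a Lawvere–Tierney topology $k$" means that the given double factorization system gives rise to a Lawvere–Tierney topology $k$ on $\mathcal{C}$; the second assertion concerns this same $k$. A double factorization system (dfs) on $\mathcal{C}$ is a triple $(\mathcal{E},\mathcal{J},\mathcal{M})$ of classes of morphisms such that: (1) $\mathrm{Iso}\cdot\mathcal{E}\subseteq\mathcal{E}$, $\mathrm{Iso}\cdot\mathcal{J}\cdot\mathrm{Iso}\subseteq\mathcal{J}$, $\mathcal{M}\cdot\mathrm{Iso}\subseteq\mathcal{M}$; (2) every morphism lies in $\mathcal{M}\cdot\mathcal{J}\cdot\mathcal{E}$; (3) for $e\colon A\to B$ in $\mathcal{E}$, $j\colon B\to C$ and $j'\colon D\to E$ in $\mathcal{J}$, $m\colon E\to F$ in $\mathcal{M}$ and $u\colon A\to D$, $v\colon C\to F$ with $vje=mj'u$, there is a unique pair $s\colon B\to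 D$, $t\colon C\to E$ with $se=u$, $j's=tj$, $mt=v$. A dfs on a topos is cartesian if the classes $\mathcal{E}$ and $\mathcal{J}\cdot\mathcal{E}$ are stable under pullbacks and $\mathcal{M}\cdot\mathcal{J}\subseteq\mathrm{Mono}$. For a monomorphism $m$, $\mathrm{char}\,m$ is its characteristic morphism. A Lawvere–Tierney topology is a morphism $k\colon\Omega\to\Omega$ with $kk=k$, $k\,\mathrm{true}=\mathrm{true}$ and $k\wedge=\wedge(k\times k)$, where $\wedge=\mathrm{char}(\mathrm{true}\times\mathrm{true})\colon\Omega\times\Omega\to\Omega$. It corresponds to the universal closure operator $c(m)\simeq(k\,\mathrm{char}\,m)^*(\mathrm{true})$ on subobjects, where $f^*$ denotes pullback along $f$. A monomorphism $m\colon A\rightarrowtail B$ is $k$-dense if $c(m)\simeq 1_B$ and $k$-closed if $c(m)\simeq m$; $\mathrm{DnsMono}_k$ and $\mathrm{ClsMono}_k$ are the classes of $k$-dense and $k$-closed monomorphisms. For every Lawvere–Tierney topology $k$, $(\mathrm{Epi},\mathrm{DnsMono}_k,\mathrm{ClsMono}_k)$ is a dfs on $\mathcal{C}$. Given two dfs's $(\mathcal{E}_i,\mathcal{J}_i,\mathcal{M}_i)$, $i=1,2$, on the same category, the second is a Bousfield localization of the first if $\mathcal{J}_1\cdot\mathcal{E}_1=\mathcal{J}_2\cdot\mathcal{E}_2$ and $\mathcal{M}_1\cdot\mathcal{E}_1\subseteq\mathcal{M}_2\cdot\mathcal{E}_2$. *)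

theory Defs
  imports Main
begin

section \<open>Categories\<close>

record ('o, 'm) category =
  Obj :: "'o set"
  Mor :: "'m set"
  Dom :: "'m \<Rightarrow> 'o"
  Cod :: "'m \<Rightarrow> 'o"
  Id :: "'o \<Rightarrow> 'm"
  Comp :: "'m \<Rightarrow> 'm \<Rightarrow> 'm"  (infixr "\<cdot>\<index>" 70)

text \<open>Composition is total as a function, but \<open>g \<cdot> f\<close> is meaningful only if
  \<open>Dom g = Cod f\<close>; all notions below are guarded accordingly.\<close>

definition hom :: "('o, 'm, 'z) category_scheme \<Rightarrow> 'o \<Rightarrow> 'o \<Rightarrow> 'm set" where
  "hom C A B = {f \<in> Mor C. Dom C f = A \<and> Cod C f = B}"

locale category =
  fixes C :: "('o, 'm, 'z) category_scheme" (structure)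
  assumes Dom_Obj: "f \<in> Mor C \<Longrightarrow> Dom C f \<in> Obj C"
    and Cod_Obj: "f \<in> Mor C \<Longrightarrow> Cod C f \<in> Obj C"
    and Id_hom: "A \<in> Obj C \<Longrightarrow> Id C A \<in> hom C A A"
    and Comp_hom: "f \<in> hom C A B \<Longrightarrow> g \<in> hom C B D \<Longrightarrow> g \<cdot> f \<in> hom C A D"
    and Comp_Id: "f \<in> hom C A B \<Longrightarrow> f \<cdot> Id C A = f"
    and Id_Comp: "f \<in> hom C A B \<Longrightarrow> Id C B \<cdot> f = f"
    and Comp_assoc:
      "f \<in> hom C A B \<Longrightarrow> g \<in> hom C B D \<Longrightarrow> h \<in> hom C D F \<Longrightarrow> h \<cdot> (g \<cdot> f) = (h \<cdot> g) \<cdot> f"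

definition Iso :: "('o, 'm, 'z) category_scheme \<Rightarrow> 'm set" where
  "Iso C = {f \<in> Mor C. \<exists>g \<in> hom C (Cod C f) (Dom C f).
     g \<cdot>\<^bsub>C\<^esub> f = Id C (Dom C f) \<and> f \<cdot>\<^bsub>C\<^esub> g = Id C (Cod C f)}"

definition Mono :: "('o, 'm, 'z) category_scheme \<Rightarrow> 'm set" where
  "Mono C = {f \<in> Mor C. \<forall>X. \<forall>g \<in> hom C X (Dom C f). \<forall>h \<in> hom C X (Dom C f).
     f \<cdot>\<^bsub>C\<^esub> g = f \<cdot>\<^bsub>C\<^esub> h \<longrightarrow> g = h}"

definition Epi :: "('o, 'm, 'z) category_scheme \<Rightarrow> 'm set" where
  "Epi C = {f \<in> Mor C. \<forall>X. \<forall>g \<in> hom C (Cod C f) X. \<forall>h \<in> hom C (Cod C f) X.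
     g \<cdot>\<^bsub>C\<^esub> f = h \<cdot>\<^bsub>C\<^esub> f \<longrightarrow> g = h}"

definition class_comp :: "('o, 'm, 'z) category_scheme \<Rightarrow> 'm set \<Rightarrow> 'm set \<Rightarrow> 'm set"
    (infixr "\<bullet>\<index>" 70) where
  "B \<bullet>\<^bsub>C\<^esub> A = {b \<cdot>\<^bsub>C\<^esub> a | a b. a \<in> A \<and> b \<in> B \<and> Dom C b = Cod C a}"

section \<open>Limits and exponentials\<close>

definition is_terminal :: "('o, 'm, 'z) category_scheme \<Rightarrow> 'o \<Rightarrow> bool" where
  "is_terminal C T \<longleftrightarrow> T \<in> Obj C \<and> (\<forall>X \<in> Obj C. \<exists>!f. f \<in> hom C X T)"

text \<open>\<open>is_pullback C f g p q\<close>: the square \<open>f \<cdot> p = g \<cdot> q\<close> is a pullback, so \<open>p\<close> is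
  the pullback of \<open>g\<close> along \<open>f\<close>, and \<open>q\<close> that of \<open>f\<close> along \<open>g\<close>.\<close>

definition is_pullback ::
    "('o, 'm, 'z) category_scheme \<Rightarrow> 'm \<Rightarrow> 'm \<Rightarrow> 'm \<Rightarrow> 'm \<Rightarrow> bool" where
  "is_pullback C f g p q \<longleftrightarrow>
     f \<in> Mor C \<and> g \<in> Mor C \<and> Cod C f = Cod C g \<and>
     p \<in> hom C (Dom C p) (Dom C f) \<and> q \<in> hom C (Dom C p) (Dom C g) \<and>
     f \<cdot>\<^bsub>C\<^esub> p = g \<cdot>\<^bsub>C\<^esub> q \<and>
     (\<forall>X. \<forall>a \<in> hom C X (Dom C f). \<forall>b \<in> hom C X (Dom C g). f \<cdot>\<^bsub>C\<^esub> a = g \<cdot>\<^bsub>C\<^esub> b \<longrightarrow>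
       (\<exists>!h. h \<in> hom C X (Dom C p) \<and> p \<cdot>\<^bsub>C\<^esub> h = a \<and> q \<cdot>\<^bsub>C\<^esub> h = b))"

definition is_product ::
    "('o, 'm, 'z) category_scheme \<Rightarrow> 'o \<Rightarrow> 'o \<Rightarrow> 'o \<times> 'm \<times> 'm \<Rightarrow> bool" where
  "is_product C A B = (\<lambda>(P, p, q). P \<in> Obj C \<and> p \<in> hom C P A \<and> q \<in> hom C P B \<and>
     (\<forall>X. \<forall>f \<in> hom C X A. \<forall>g \<in> hom C X B.
       \<exists>!h. h \<in> hom C X P \<and> p \<cdot>\<^bsub>C\<^esub> h = f \<and> q \<cdot>\<^bsub>C\<^esub> h = g))"

text \<open>Products, unique only up to isomorphism, are fixed by an arbitrary choice.\<close>

definition prod_cone :: "('o, 'm, 'z) category_scheme \<Rightarrow> 'o \<Rightarrow> 'o \<Rightarrow> 'o \<times> 'm \<times> 'm" where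
  "prod_cone C A B = (SOME c. is_product C A B c)"

definition prod_obj :: "('o, 'm, 'z) category_scheme \<Rightarrow> 'o \<Rightarrow> 'o \<Rightarrow> 'o" where
  "prod_obj C A B = fst (prod_cone C A B)"

definition proj1 :: "('o, 'm, 'z) category_scheme \<Rightarrow> 'o \<Rightarrow> 'o \<Rightarrow> 'm" where
  "proj1 C A B = fst (snd (prod_cone C A B))"

definition proj2 :: "('o, 'm, 'z) category_scheme \<Rightarrow> 'o \<Rightarrow> 'o \<Rightarrow> 'm" where
  "proj2 C A B = snd (snd (prod_cone C A B))"

text \<open>\<open>prod_map C f g\<close> is \<open>f \<times> g : A \<times> B \<rightarrow> A' \<times> B'\<close> for \<open>f : A \<rightarrow> A'\<close> and
  \<open>g : B \<rightarrow> B'\<close>.\<close>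

definition prod_map :: "('o, 'm, 'z) category_scheme \<Rightarrow> 'm \<Rightarrow> 'm \<Rightarrow> 'm" where
  "prod_map C f g = (THE h.
     h \<in> hom C (prod_obj C (Dom C f) (Dom C g)) (prod_obj C (Cod C f) (Cod C g)) \<and>
     proj1 C (Cod C f) (Cod C g) \<cdot>\<^bsub>C\<^esub> h = f \<cdot>\<^bsub>C\<^esub> proj1 C (Dom C f) (Dom C g) \<and>
     proj2 C (Cod C f) (Cod C g) \<cdot>\<^bsub>C\<^esub> h = g \<cdot>\<^bsub>C\<^esub> proj2 C (Dom C f) (Dom C g))"

text \<open>\<open>is_exponential C A B P ev\<close>: the object \<open>P\<close> with evaluation \<open>ev : P \<times> A \<rightarrow> B\<close> is an
  exponential of base \<open>B\<close> and exponent \<open>A\<close>.\<close>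

definition is_exponential ::
    "('o, 'm, 'z) category_scheme \<Rightarrow> 'o \<Rightarrow> 'o \<Rightarrow> 'o \<Rightarrow> 'm \<Rightarrow> bool" where
  "is_exponential C A B P ev \<longleftrightarrow> P \<in> Obj C \<and> ev \<in> hom C (prod_obj C P A) B \<and>
     (\<forall>X \<in> Obj C. \<forall>f \<in> hom C (prod_obj C X A) B.
       \<exists>!g. g \<in> hom C X P \<and> ev \<cdot>\<^bsub>C\<^esub> prod_map C g (Id C A) = f)"

section \<open>Elementary toposes\<close>

definition is_char ::
    "('o, 'm, 'z) category_scheme \<Rightarrow> 'm \<Rightarrow> 'm \<Rightarrow> 'm \<Rightarrow> bool" where
  "is_char C tr m \<chi> \<longleftrightarrow> \<chi> \<in> hom C (Cod C m) (Cod C tr) \<and> (\<exists>u. is_pullback C \<chi> tr m u)"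

definition is_subobject_classifier :: "('o, 'm, 'z) category_scheme \<Rightarrow> 'm \<Rightarrow> bool" where
  "is_subobject_classifier C tr \<longleftrightarrow> tr \<in> Mor C \<and> is_terminal C (Dom C tr) \<and>
     (\<forall>m \<in> Mono C. \<exists>!\<chi>. is_char C tr m \<chi>)"

text \<open>Finite completeness is expressed by a terminal object (\<open>Dom C tr\<close>) and pullbacks. The
  existence of products, a consequence of these, is what gives the chosen products in
  \<open>exponentials\<close> their meaning.\<close>

locale elementary_topos = category +
  fixes tr :: 'm
  assumes pullbacks: "f \<in> Mor C \<Longrightarrow> g \<in> Mor C \<Longrightarrow> Cod C f = Cod C g \<Longrightarrow>
      \<exists>p q. is_pullback C f g p q"
    and exponentials: "A \<in> Obj C \<Longrightarrow> B \<in> Obj C \<Longrightarrow> \<exists>P ev. is_exponential C A B P ev"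
    and subobject_classifier: "is_subobject_classifier C tr"

definition char_mor :: "('o, 'm, 'z) category_scheme \<Rightarrow> 'm \<Rightarrow> 'm \<Rightarrow> 'm" where
  "char_mor C tr m = (THE \<chi>. is_char C tr m \<chi>)"

definition conj_mor :: "('o, 'm, 'z) category_scheme \<Rightarrow> 'm \<Rightarrow> 'm" where
  "conj_mor C tr = char_mor C tr (prod_map C tr tr)"

definition lawvere_tierney :: "('o, 'm, 'z) category_scheme \<Rightarrow> 'm \<Rightarrow> 'm \<Rightarrow> bool" where
  "lawvere_tierney C tr k \<longleftrightarrow> k \<in> hom C (Cod C tr) (Cod C tr) \<and>
     k \<cdot>\<^bsub>C\<^esub> k = k \<and> k \<cdot>\<^bsub>C\<^esub> tr = tr \<and>
     k \<cdot>\<^bsub>C\<^esub> conj_mor C tr = conj_mor C tr \<cdot>\<^bsub>C\<^esub> prod_map C k k"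

definition inv_image :: "('o, 'm, 'z) category_scheme \<Rightarrow> 'm \<Rightarrow> 'm \<Rightarrow> 'm" where
  "inv_image C f n = (SOME p. \<exists>q. is_pullback C f n p q)"

text \<open>\<open>subobj_equiv C m n\<close>: \<open>m\<close> and \<open>n\<close> represent the same subobject of their codomain.\<close>

definition subobj_equiv :: "('o, 'm, 'z) category_scheme \<Rightarrow> 'm \<Rightarrow> 'm \<Rightarrow> bool" where
  "subobj_equiv C m n \<longleftrightarrow> m \<in> Mono C \<and> n \<in> Mono C \<and> Cod C m = Cod C n \<and>
     (\<exists>i \<in> Iso C. i \<in> hom C (Dom C m) (Dom C n) \<and> n \<cdot>\<^bsub>C\<^esub> i = m)"

definition closure_op :: "('o, 'm, 'z) category_scheme \<Rightarrow> 'm \<Rightarrow> 'm \<Rightarrow> 'm \<Rightarrow> 'm" where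
  "closure_op C tr k m = inv_image C (k \<cdot>\<^bsub>C\<^esub> char_mor C tr m) tr"

definition DnsMono :: "('o, 'm, 'z) category_scheme \<Rightarrow> 'm \<Rightarrow> 'm \<Rightarrow> 'm set" where
  "DnsMono C tr k = {m \<in> Mono C. subobj_equiv C (closure_op C tr k m) (Id C (Cod C m))}"

definition ClsMono :: "('o, 'm, 'z) category_scheme \<Rightarrow> 'm \<Rightarrow> 'm \<Rightarrow> 'm set" where
  "ClsMono C tr k = {m \<in> Mono C. subobj_equiv C (closure_op C tr k m) m}"

section \<open>Double factorization systems\<close>

definition is_dfs ::
    "('o, 'm, 'z) category_scheme \<Rightarrow> 'm set \<Rightarrow> 'm set \<Rightarrow> 'm set \<Rightarrow> bool" where
  "is_dfs C \<E> \<J> \<M> \<longleftrightarrow>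
     \<E> \<subseteq> Mor C \<and> \<J> \<subseteq> Mor C \<and> \<M> \<subseteq> Mor C \<and>
     Iso C \<bullet>\<^bsub>C\<^esub> \<E> \<subseteq> \<E> \<and> Iso C \<bullet>\<^bsub>C\<^esub> \<J> \<bullet>\<^bsub>C\<^esub> Iso C \<subseteq> \<J> \<and> \<M> \<bullet>\<^bsub>C\<^esub> Iso C \<subseteq> \<M> \<and>
     Mor C \<subseteq> \<M> \<bullet>\<^bsub>C\<^esub> \<J> \<bullet>\<^bsub>C\<^esub> \<E> \<and>
     (\<forall>A B D A' B' D' e j j' m u v.
        e \<in> \<E> \<and> e \<in> hom C A B \<and> j \<in> \<J> \<and> j \<in> hom C B D \<and>
        j' \<in> \<J> \<and> j' \<in> hom C A' B' \<and> m \<in> \<M> \<and> m \<in> hom C B' D' \<and>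
        u \<in> hom C A A' \<and> v \<in> hom C D D' \<and>
        v \<cdot>\<^bsub>C\<^esub> j \<cdot>\<^bsub>C\<^esub> e = m \<cdot>\<^bsub>C\<^esub> j' \<cdot>\<^bsub>C\<^esub> u \<longrightarrow>
        (\<exists>!st. case st of (s, t) \<Rightarrow>
           s \<in> hom C B A' \<and> t \<in> hom C D B' \<and>
           s \<cdot>\<^bsub>C\<^esub> e = u \<and> j' \<cdot>\<^bsub>C\<^esub> s = t \<cdot>\<^bsub>C\<^esub> j \<and> m \<cdot>\<^bsub>C\<^esub> t = v))"

definition pullback_stable :: "('o, 'm, 'z) category_scheme \<Rightarrow> 'm set \<Rightarrow> bool" where
  "pullback_stable C S \<longleftrightarrow> (\<forall>f g p q. is_pullback C f g p q \<and> f \<in> S \<longrightarrow> q \<in> S)"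

definition cartesian_dfs ::
    "('o, 'm, 'z) category_scheme \<Rightarrow> 'm set \<Rightarrow> 'm set \<Rightarrow> 'm set \<Rightarrow> bool" where
  "cartesian_dfs C \<E> \<J> \<M> \<longleftrightarrow> is_dfs C \<E> \<J> \<M> \<and>
     pullback_stable C \<E> \<and> pullback_stable C (\<J> \<bullet>\<^bsub>C\<^esub> \<E>) \<and> \<M> \<bullet>\<^bsub>C\<^esub> \<J> \<subseteq> Mono C"

text \<open>The topology generated by \<open>(\<E>, \<J>, \<M>)\<close> is the one whose universal closure operator
  sends a monomorphism \<open>n \<cdot> j \<cdot> e\<close>, factored according to \<open>(\<E>, \<J>, \<M>)\<close>, to its
  \<open>\<M>\<close>-part \<open>n\<close>. For \<open>n \<cdot> j \<cdot> e = tr\<close> this says that \<open>k\<close> is the characteristic morphism of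
  the \<open>\<M>\<close>-part of \<open>tr\<close>; so \<open>k\<close> is determined by \<open>(\<E>, \<J>, \<M>)\<close>.\<close>

definition generates_topology ::
    "('o, 'm, 'z) category_scheme \<Rightarrow> 'm \<Rightarrow> 'm set \<Rightarrow> 'm set \<Rightarrow> 'm set \<Rightarrow> 'm \<Rightarrow> bool" where
  "generates_topology C tr \<E> \<J> \<M> k \<longleftrightarrow> lawvere_tierney C tr k \<and>
     (\<forall>e \<in> \<E>. \<forall>j \<in> \<J>. \<forall>n \<in> \<M>.
        Cod C e = Dom C j \<and> Cod C j = Dom C n \<and> n \<cdot>\<^bsub>C\<^esub> j \<cdot>\<^bsub>C\<^esub> e \<in> Mono C \<longrightarrow>
        subobj_equiv C (closure_op C tr k (n \<cdot>\<^bsub>C\<^esub> j \<cdot>\<^bsub>C\<^esub> e)) n)"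

text \<open>The system \<open>(\<E>\<^sub>2, \<J>\<^sub>2, \<M>\<^sub>2)\<close> is a Bousfield localization of \<open>(\<E>\<^sub>1, \<J>\<^sub>1, \<M>\<^sub>1)\<close>.\<close>

definition bousfield_localization ::
    "('o, 'm, 'z) category_scheme \<Rightarrow> 'm set \<times> 'm set \<times> 'm set \<Rightarrow>
      'm set \<times> 'm set \<times> 'm set \<Rightarrow> bool" where
  "bousfield_localization C = (\<lambda>(\<E>\<^sub>2, \<J>\<^sub>2, \<M>\<^sub>2) (\<E>\<^sub>1, \<J>\<^sub>1, \<M>\<^sub>1).
     is_dfs C \<E>\<^sub>1 \<J>\<^sub>1 \<M>\<^sub>1 \<and> is_dfs C \<E>\<^sub>2 \<J>\<^sub>2 \<M>\<^sub>2 \<and>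
     \<J>\<^sub>1 \<bullet>\<^bsub>C\<^esub> \<E>\<^sub>1 = \<J>\<^sub>2 \<bullet>\<^bsub>C\<^esub> \<E>\<^sub>2 \<and> \<M>\<^sub>1 \<bullet>\<^bsub>C\<^esub> \<E>\<^sub>1 \<subseteq> \<M>\<^sub>2 \<bullet>\<^bsub>C\<^esub> \<E>\<^sub>2)"

end

theory Submission
  imports Defs
begin

text \<open>Since \<open>\<M> \<bullet> \<J>\<close> consists of monomorphisms, \<open>L = \<J> \<bullet> \<E>\<close> and \<open>\<M>\<close> form a pullback-stable
  orthogonal factorization system with \<open>\<M> \<subseteq> Mono\<close>, and \<open>k\<close> is the characteristic morphism of
  the \<open>\<M>\<close>-part of \<open>tr\<close>. Stability shows that the closure of a monomorphism is its \<open>\<M>\<close>-part; hence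
  the closed monomorphisms are those in \<open>\<M>\<close> and the dense ones those in \<open>L\<close>. Monomorphisms
  of a topos are equalizers, so epimorphisms are left orthogonal to them; this gives
  \<open>Epi \<subseteq> \<E>\<close> and, together with image factorizations, \<open>DnsMono \<bullet> Epi = L\<close>.\<close>

section \<open>Categories\<close>

text \<open>Finite limits, exponentials and \<open>tr\<close> are the only structure at hand, and
  pushouts are not part of it. Images are therefore built by internal quantification over a power
  object instead of from cokernel pairs. Subobjects are handled through generalized elements:
  \<open>x \<sqsubseteq> m\<close> means that \<open>x\<close> factors through \<open>m\<close>.
  Morphisms into \<open>\<Omega>\<close> agree once they send the same \<open>x\<close> to true, so
  each axiom of a topology becomes an equivalence between factorings. With \<open>n\<^sub>0\<close>
  the \<open>\<M>\<close>-part of \<open>tr\<close>, idempotence of \<open>k\<close> says that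
  \<open>n\<^sub>0\<close> is its own \<open>\<M>\<close>-part, and compatibility with conjunction
  says that \<open>tr\<close> x \<open>tr\<close> has the \<open>\<M>\<close>-part
  \<open>n\<^sub>0\<close> x \<open>n\<^sub>0\<close>. Since \<open>\<M>\<close> is monic, diagonals
  are automatically unique, and orthogonality shrinks to one implication: if
  \<open>v \<cdot> l \<sqsubseteq> n\<close> then \<open>v \<sqsubseteq> n\<close>. To put a
  morphism into \<open>L\<close>, one shows that the identity factors through its
  \<open>\<M>\<close>-part: a split monomorphism is invertible, and \<open>L\<close> absorbs
  isomorphisms.\<close>

context category
begin

lemma hom_iff [simp]: "f \<in> hom C A B \<longleftrightarrow> f \<in> Mor C \<and> Dom C f = A \<and> Cod C f = B"
  by (simp add: hom_def)

lemma Dom_in_Obj [simp]: "f \<in> Mor C \<Longrightarrow> Dom C f \<in> Obj C"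
  by (rule Dom_Obj)

lemma Cod_in_Obj [simp]: "f \<in> Mor C \<Longrightarrow> Cod C f \<in> Obj C"
  by (rule Cod_Obj)

lemma Id_simps [simp]:
  assumes "A \<in> Obj C"
  shows "Id C A \<in> Mor C" "Dom C (Id C A) = A" "Cod C (Id C A) = A"
  using Id_hom[OF assms] by simp_all

lemma Comp_simps [simp]:
  assumes "f \<in> Mor C" "g \<in> Mor C" "Dom C g = Cod C f"
  shows "g \<cdot> f \<in> Mor C" "Dom C (g \<cdot> f) = Dom C f" "Cod C (g \<cdot> f) = Cod C g"
  using Comp_hom[of f "Dom C f" "Cod C f" g "Cod C g"] assms by simp_all

lemma Comp_assoc' [simp]:
  assumes "f \<in> Mor C" "g \<in> Mor C" "h \<in> Mor C" "Dom C g = Cod C f" "Dom C h = Cod C g"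
  shows "(h \<cdot> g) \<cdot> f = h \<cdot> g \<cdot> f"
  using Comp_assoc[of f "Dom C f" "Cod C f" g "Cod C g" h "Cod C h"] assms by simp

lemma Comp_Id' [simp]: "f \<in> Mor C \<Longrightarrow> Dom C f = A \<Longrightarrow> f \<cdot> Id C A = f"
  using Comp_Id[of f A "Cod C f"] by simp

lemma Id_Comp' [simp]: "f \<in> Mor C \<Longrightarrow> Cod C f = B \<Longrightarrow> Id C B \<cdot> f = f"
  using Id_Comp[of f "Dom C f" B] by simp

text \<open>The simplifier nests composites to the right, so an equation between two-fold composites
  no longer matches inside a longer one. This rule and \<open>Comp_extend\<close> append the missing
  right factor.\<close>

lemma Comp_eq_extend:
  assumes "a \<cdot> b = c \<cdot> d"
    and "a \<in> Mor C" "b \<in> Mor C" "Dom C a = Cod C b"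
    and "c \<in> Mor C" "d \<in> Mor C" "Dom C c = Cod C d"
    and "x \<in> Mor C" "Cod C x = Dom C b" "Cod C x = Dom C d"
  shows "a \<cdot> b \<cdot> x = c \<cdot> d \<cdot> x"
  using assms by (metis Comp_assoc')

lemma Comp_extend:
  assumes "a \<cdot> b = c" "a \<in> Mor C" "b \<in> Mor C" "Dom C a = Cod C b"
    and "x \<in> Mor C" "Cod C x = Dom C b"
  shows "a \<cdot> b \<cdot> x = c \<cdot> x"
  using assms by (metis Comp_assoc')

section \<open>Composites of classes; monomorphisms, epimorphisms and isomorphisms\<close>

lemma class_compI:
  "a \<in> S \<Longrightarrow> b \<in> T \<Longrightarrow> Dom C b = Cod C a \<Longrightarrow> b \<cdot> a \<in> T \<bullet> S"
  by (auto simp: class_comp_def)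

lemma class_compE:
  assumes "f \<in> T \<bullet> S"
  obtains a b where "a \<in> S" "b \<in> T" "Dom C b = Cod C a" "f = b \<cdot> a"
  using assms unfolding class_comp_def by blast

lemma Mono_Mor [simp]: "m \<in> Mono C \<Longrightarrow> m \<in> Mor C"
  by (simp add: Mono_def)

lemma Mono_cancel:
  assumes "m \<in> Mono C" "m \<cdot> g = m \<cdot> h" "g \<in> Mor C" "h \<in> Mor C"
    "Cod C g = Dom C m" "Cod C h = Dom C m" "Dom C g = Dom C h"
  shows "g = h"
proof -
  have "\<forall>X. \<forall>g \<in> hom C X (Dom C m). \<forall>h \<in> hom C X (Dom C m). m \<cdot> g = m \<cdot> h \<longrightarrow> g = h"
    using assms(1) unfolding Mono_def by (elim CollectE conjE)
  then show ?thesis using assms(2-) by (metis hom_iff)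
qed

lemma MonoI:
  assumes "m \<in> Mor C"
    and "\<And>g h. g \<in> Mor C \<Longrightarrow> h \<in> Mor C \<Longrightarrow> Dom C g = Dom C h \<Longrightarrow>
      Cod C g = Dom C m \<Longrightarrow> Cod C h = Dom C m \<Longrightarrow> m \<cdot> g = m \<cdot> h \<Longrightarrow> g = h"
  shows "m \<in> Mono C"
  unfolding Mono_def
proof (intro CollectI conjI allI ballI impI assms(1))
  fix X g h
  assume gh: "g \<in> hom C X (Dom C m)" "h \<in> hom C X (Dom C m)" "m \<cdot> g = m \<cdot> h"
  show "g = h" by (rule assms(2)) (use gh in simp_all)
qed

lemma Epi_Mor [simp]: "e \<in> Epi C \<Longrightarrow> e \<in> Mor C"
  by (simp add: Epi_def)

lemma Epi_cancel:
  assumes "e \<in> Epi C" "g \<cdot> e = h \<cdot> e" "g \<in> Mor C" "h \<in> Mor C"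
    "Dom C g = Cod C e" "Dom C h = Cod C e" "Cod C g = Cod C h"
  shows "g = h"
proof -
  have "\<forall>X. \<forall>g \<in> hom C (Cod C e) X. \<forall>h \<in> hom C (Cod C e) X. g \<cdot> e = h \<cdot> e \<longrightarrow> g = h"
    using assms(1) unfolding Epi_def by (elim CollectE conjE)
  then show ?thesis using assms(2-) by (metis hom_iff)
qed

lemma EpiI:
  assumes "e \<in> Mor C"
    and "\<And>g h. g \<in> Mor C \<Longrightarrow> h \<in> Mor C \<Longrightarrow> Cod C g = Cod C h \<Longrightarrow>
      Dom C g = Cod C e \<Longrightarrow> Dom C h = Cod C e \<Longrightarrow> g \<cdot> e = h \<cdot> e \<Longrightarrow> g = h"
  shows "e \<in> Epi C"
  unfolding Epi_def
proof (intro CollectI conjI allI ballI impI assms(1))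
  fix X g h
  assume gh: "g \<in> hom C (Cod C e) X" "h \<in> hom C (Cod C e) X" "g \<cdot> e = h \<cdot> e"
  show "g = h" by (rule assms(2)) (use gh in simp_all)
qed

lemma Iso_Mor [simp]: "f \<in> Iso C \<Longrightarrow> f \<in> Mor C"
  by (simp add: Iso_def)

lemma IsoE:
  assumes "f \<in> Iso C"
  obtains g where "g \<in> Mor C" "Dom C g = Cod C f" "Cod C g = Dom C f"
    "g \<cdot> f = Id C (Dom C f)" "f \<cdot> g = Id C (Cod C f)"
proof -
  have "\<exists>g \<in> hom C (Cod C f) (Dom C f). g \<cdot> f = Id C (Dom C f) \<and> f \<cdot> g = Id C (Cod C f)"
    using assms unfolding Iso_def by (elim CollectE conjE)
  then obtain g where "g \<in> hom C (Cod C f) (Dom C f)"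
    "g \<cdot> f = Id C (Dom C f)" "f \<cdot> g = Id C (Cod C f)"
    by (elim bexE conjE)
  then show thesis by (intro that[of g]) simp_all
qed

lemma IsoI:
  assumes "f \<in> Mor C" "g \<in> Mor C" "Dom C g = Cod C f" "Cod C g = Dom C f"
    "g \<cdot> f = Id C (Dom C f)" "f \<cdot> g = Id C (Cod C f)"
  shows "f \<in> Iso C"
  unfolding Iso_def by (intro CollectI conjI bexI[of _ g]) (use assms in simp_all)

lemma Id_Iso [simp]: "A \<in> Obj C \<Longrightarrow> Id C A \<in> Iso C"
  by (rule IsoI[of _ "Id C A"]) simp_all

lemma Iso_Mono:
  assumes "f \<in> Iso C"
  shows "f \<in> Mono C"
proof -
  obtain i where i: "i \<in> Mor C" "Dom C i = Cod C f" "Cod C i = Dom C f"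
    "i \<cdot> f = Id C (Dom C f)"
    using assms by (rule IsoE)
  have f: "f \<in> Mor C" using assms by simp
  show ?thesis
  proof (rule MonoI[OF f])
    fix g h
    assume gh: "g \<in> Mor C" "h \<in> Mor C" "Cod C g = Dom C f" "Cod C h = Dom C f"
      and eq: "f \<cdot> g = f \<cdot> h"
    have "g = (i \<cdot> f) \<cdot> g" using i gh f by simp
    also have "\<dots> = (i \<cdot> f) \<cdot> h" using i(1-3) gh f eq by simp
    also have "\<dots> = h" using i gh f by simp
    finally show "g = h" .
  qed
qed

lemma Iso_Epi:
  assumes "f \<in> Iso C"
  shows "f \<in> Epi C"
proof -
  obtain i where i: "i \<in> Mor C" "Dom C i = Cod C f" "Cod C i = Dom C f"
    "f \<cdot> i = Id C (Cod C f)"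
    using assms by (rule IsoE)
  have f: "f \<in> Mor C" using assms by simp
  show ?thesis
  proof (rule EpiI[OF f])
    fix g h
    assume gh: "g \<in> Mor C" "h \<in> Mor C" "Dom C g = Cod C f" "Dom C h = Cod C f"
      and eq: "g \<cdot> f = h \<cdot> f"
    have "g = g \<cdot> f \<cdot> i" using i gh f by simp
    also have "\<dots> = h \<cdot> f \<cdot> i" using Comp_eq_extend[OF eq] i(1-3) gh f by simp
    also have "\<dots> = h" using i gh f by simp
    finally show "g = h" .
  qed
qed

lemma Mono_Comp:
  assumes "m \<in> Mono C" "n \<in> Mono C" "Dom C n = Cod C m"
  shows "n \<cdot> m \<in> Mono C"
proof (rule MonoI)
  show "n \<cdot> m \<in> Mor C" using assms by simp
next
  fix g h
  assume gh: "g \<in> Mor C" "h \<in> Mor C" "Dom C g = Dom C h"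
    "Cod C g = Dom C (n \<cdot> m)" "Cod C h = Dom C (n \<cdot> m)" "(n \<cdot> m) \<cdot> g = (n \<cdot> m) \<cdot> h"
  then have "n \<cdot> m \<cdot> g = n \<cdot> m \<cdot> h" using assms by simp
  then have "m \<cdot> g = m \<cdot> h"
    using gh assms by - (rule Mono_cancel[OF assms(2)], simp_all)
  then show "g = h"
    using gh assms by - (rule Mono_cancel[OF assms(1)], simp_all)
qed

lemma Epi_Comp:
  assumes "d \<in> Epi C" "e \<in> Epi C" "Dom C e = Cod C d"
  shows "e \<cdot> d \<in> Epi C"
proof (rule EpiI)
  show "e \<cdot> d \<in> Mor C" using assms by simp
next
  fix g h
  assume gh: "g \<in> Mor C" "h \<in> Mor C" "Cod C g = Cod C h"
    "Dom C g = Cod C (e \<cdot> d)" "Dom C h = Cod C (e \<cdot> d)" "g \<cdot> e \<cdot> d = h \<cdot> e \<cdot> d"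
  then have "(g \<cdot> e) \<cdot> d = (h \<cdot> e) \<cdot> d" using assms by simp
  then have "g \<cdot> e = h \<cdot> e"
    using gh assms by - (rule Epi_cancel[OF assms(1)], simp_all)
  then show "g = h"
    using gh assms by - (rule Epi_cancel[OF assms(2)], simp_all)
qed

section \<open>Pullback squares\<close>

lemma is_pullbackD:
  assumes "is_pullback C f g p q"
  shows "f \<in> Mor C" "g \<in> Mor C" "Cod C f = Cod C g"
    "p \<in> Mor C" "Cod C p = Dom C f" "q \<in> Mor C" "Dom C q = Dom C p" "Cod C q = Dom C g"
    "f \<cdot> p = g \<cdot> q"
  using assms unfolding is_pullback_def hom_iff by - (elim conjE; assumption)+

lemma is_pullback_ex1:
  assumes "is_pullback C f g p q"
    and "a \<in> hom C X (Dom C f)" "b \<in> hom C X (Dom C g)" "f \<cdot> a = g \<cdot> b"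
  shows "\<exists>!h. h \<in> hom C X (Dom C p) \<and> p \<cdot> h = a \<and> q \<cdot> h = b"
proof -
  have "\<forall>X. \<forall>a \<in> hom C X (Dom C f). \<forall>b \<in> hom C X (Dom C g). f \<cdot> a = g \<cdot> b \<longrightarrow>
      (\<exists>!h. h \<in> hom C X (Dom C p) \<and> p \<cdot> h = a \<and> q \<cdot> h = b)"
    using assms(1) unfolding is_pullback_def by (elim conjE)
  then show ?thesis using assms(2-) by blast
qed

lemma is_pullback_lift:
  assumes "is_pullback C f g p q" "a \<in> Mor C" "b \<in> Mor C" "Dom C a = Dom C b"
    "Cod C a = Dom C f" "Cod C b = Dom C g" "f \<cdot> a = g \<cdot> b"
  obtains h where "h \<in> Mor C" "Dom C h = Dom C a" "Cod C h = Dom C p" "p \<cdot> h = a" "q \<cdot> h = b"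
proof -
  have "\<exists>!h. h \<in> hom C (Dom C a) (Dom C p) \<and> p \<cdot> h = a \<and> q \<cdot> h = b"
    by (rule is_pullback_ex1[OF assms(1)]) (use assms in simp_all)
  then obtain h where "h \<in> hom C (Dom C a) (Dom C p) \<and> p \<cdot> h = a \<and> q \<cdot> h = b"
    by (rule ex1E)
  then show thesis by (intro that[of h]) simp_all
qed

lemma is_pullback_unique:
  assumes pb: "is_pullback C f g p q" and h: "h \<in> Mor C" "h' \<in> Mor C" "Dom C h = Dom C h'"
    "Cod C h = Dom C p" "Cod C h' = Dom C p" and eq: "p \<cdot> h = p \<cdot> h'" "q \<cdot> h = q \<cdot> h'"
  shows "h = h'"
proof -
  note D = is_pullbackD[OF pb]
  have fg: "f \<cdot> p \<cdot> h = g \<cdot> q \<cdot> h"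
    using Comp_eq_extend[OF D(9)] D h by simp
  have "\<exists>!k. k \<in> hom C (Dom C h) (Dom C p) \<and> p \<cdot> k = p \<cdot> h \<and> q \<cdot> k = q \<cdot> h"
    by (rule is_pullback_ex1[OF pb]) (use fg D h in simp_all)
  then show ?thesis
    by (rule ex1E) (metis h eq hom_iff)
qed

lemma is_pullback_Mono:
  assumes pb: "is_pullback C f g p q" and "g \<in> Mono C"
  shows "p \<in> Mono C"
proof (rule MonoI)
  note D = is_pullbackD[OF pb]
  show "p \<in> Mor C" by (rule D)
  fix a b
  assume ab: "a \<in> Mor C" "b \<in> Mor C" "Dom C a = Dom C b" "Cod C a = Dom C p"
    "Cod C b = Dom C p" "p \<cdot> a = p \<cdot> b"
  have "g \<cdot> q \<cdot> a = f \<cdot> p \<cdot> a"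
    by (rule Comp_eq_extend[OF D(9)[symmetric]]) (use D ab in simp_all)
  also have "\<dots> = f \<cdot> p \<cdot> b" by (simp only: ab(6))
  also have "\<dots> = g \<cdot> q \<cdot> b"
    by (rule Comp_eq_extend[OF D(9)]) (use D ab in simp_all)
  finally have "g \<cdot> q \<cdot> a = g \<cdot> q \<cdot> b" .
  then have "q \<cdot> a = q \<cdot> b"
    using ab D by - (rule Mono_cancel[OF assms(2)], simp_all)
  then show "a = b"
    using ab by - (rule is_pullback_unique[OF pb], simp_all)
qed

section \<open>Factoring through a morphism, and equivalence of subobjects\<close>

text \<open>For monic \<open>m\<close> this is membership of the generalized element
  \<open>x\<close> in the subobject \<open>m\<close>. Arbitrary \<open>m\<close> is allowed, so that
  the relation is a preorder with \<open>x \<cdot> y \<sqsubseteq> x\<close>.\<close>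

definition factors :: "'m \<Rightarrow> 'm \<Rightarrow> bool" (infix "\<sqsubseteq>" 50) where
  "x \<sqsubseteq> m \<longleftrightarrow> x \<in> Mor C \<and> m \<in> Mor C \<and> Cod C x = Cod C m \<and>
     (\<exists>h. h \<in> Mor C \<and> Dom C h = Dom C x \<and> Cod C h = Dom C m \<and> m \<cdot> h = x)"

lemma factorsE:
  assumes "x \<sqsubseteq> m"
  obtains h where "h \<in> Mor C" "Dom C h = Dom C x" "Cod C h = Dom C m" "m \<cdot> h = x"
    "x \<in> Mor C" "m \<in> Mor C" "Cod C x = Cod C m"
  using assms unfolding factors_def by (elim conjE exE) (rule that; assumption)

lemma factorsI:
  assumes "m \<in> Mor C" "h \<in> Mor C" "Cod C h = Dom C m" "m \<cdot> h = x"
  shows "x \<sqsubseteq> m"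
  unfolding factors_def by (intro conjI exI[of _ h]) (use assms in \<open>simp_all flip: assms(4)\<close>)

lemma factors_refl: "m \<in> Mor C \<Longrightarrow> m \<sqsubseteq> m"
  by (rule factorsI[of m "Id C (Dom C m)"]) simp_all

lemma factors_trans:
  assumes "x \<sqsubseteq> y" "y \<sqsubseteq> z"
  shows "x \<sqsubseteq> z"
proof -
  obtain g where g: "g \<in> Mor C" "Cod C g = Dom C y" "y \<cdot> g = x"
    using assms(1) by (rule factorsE)
  obtain h where h: "h \<in> Mor C" "Dom C h = Dom C y" "Cod C h = Dom C z" "z \<cdot> h = y"
    "y \<in> Mor C" "z \<in> Mor C"
    using assms(2) by (rule factorsE)
  have "z \<cdot> h \<cdot> g = x" using Comp_extend[OF h(4)] g h by simp
  then show ?thesis using g h by (intro factorsI[of z "h \<cdot> g"]) simp_all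
qed

lemma factors_Comp:
  assumes "x \<sqsubseteq> m" "y \<in> Mor C" "Cod C y = Dom C x"
  shows "x \<cdot> y \<sqsubseteq> m"
proof -
  have "x \<cdot> y \<sqsubseteq> x" using assms by (intro factorsI[of x y]) (auto elim: factorsE)
  then show ?thesis using assms(1) by (rule factors_trans)
qed

text \<open>A section \<open>h\<close> of \<open>m\<close> satisfies
  \<open>m \<cdot> h \<cdot> m = m\<close>; cancelling \<open>m\<close> on the left makes
  \<open>h\<close> a two-sided inverse.\<close>

lemma Mono_split_Iso:
  assumes m: "m \<in> Mono C" and "Id C (Cod C m) \<sqsubseteq> m"
  shows "m \<in> Iso C"
proof -
  obtain h where h: "h \<in> Mor C" "Dom C h = Cod C m" "Cod C h = Dom C m" "m \<cdot> h = Id C (Cod C m)"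
    using assms(2) m by (auto elim: factorsE)
  have "m \<cdot> h \<cdot> m = m \<cdot> Id C (Dom C m)"
    using Comp_extend[OF h(4)] h m by simp
  then have "h \<cdot> m = Id C (Dom C m)"
    using h m by - (rule Mono_cancel[OF m], simp_all)
  then show ?thesis using h m by (intro IsoI[of m h]) simp_all
qed

text \<open>Antisymmetry of the subobject order: the two comparison morphisms are mutually inverse
  because \<open>m\<close> and \<open>n\<close> cancel. Equivalence can thus be tested on
  generalized elements, without exhibiting an isomorphism.\<close>

lemma subobj_equiv_iff:
  "subobj_equiv C m n \<longleftrightarrow> m \<in> Mono C \<and> n \<in> Mono C \<and> m \<sqsubseteq> n \<and> n \<sqsubseteq> m"
proof
  assume "subobj_equiv C m n"
  then obtain i where mn: "m \<in> Mono C" "n \<in> Mono C" "Cod C m = Cod C n"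
    and i: "i \<in> Iso C" "i \<in> hom C (Dom C m) (Dom C n)" "n \<cdot> i = m"
    unfolding subobj_equiv_def by (elim conjE bexE)
  obtain g where g: "g \<in> Mor C" "Dom C g = Cod C i" "Cod C g = Dom C i" "i \<cdot> g = Id C (Cod C i)"
    using i(1) by (rule IsoE)
  have "m \<cdot> g = n \<cdot> i \<cdot> g"
    by (rule Comp_extend[OF i(3), symmetric]) (use i(1,2) g(1-3) mn in simp_all)
  also have "\<dots> = n" using g(4) i(2) mn by simp
  finally have "n \<sqsubseteq> m" using g(1-3) i(2) mn by (intro factorsI[of m g]) simp_all
  moreover have "m \<sqsubseteq> n" using i(2,3) mn by (intro factorsI[of n i]) simp_all
  ultimately show "m \<in> Mono C \<and> n \<in> Mono C \<and> m \<sqsubseteq> n \<and> n \<sqsubseteq> m" using mn by blast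
next
  assume "m \<in> Mono C \<and> n \<in> Mono C \<and> m \<sqsubseteq> n \<and> n \<sqsubseteq> m"
  then have R: "m \<in> Mono C" "n \<in> Mono C" and mn: "m \<sqsubseteq> n" and nm: "n \<sqsubseteq> m" by simp_all
  obtain h where h: "h \<in> Mor C" "Dom C h = Dom C m" "Cod C h = Dom C n" "n \<cdot> h = m" "Cod C m = Cod C n"
    using mn by (rule factorsE)
  obtain g where g: "g \<in> Mor C" "Dom C g = Dom C n" "Cod C g = Dom C m" "m \<cdot> g = n"
    using nm by (rule factorsE)
  have "m \<cdot> g \<cdot> h = n \<cdot> h"
    by (rule Comp_extend[OF g(4)]) (use g(1-3) h(1-3) R in simp_all)
  also have "\<dots> = m \<cdot> Id C (Dom C m)" using h(4) R by simp
  finally have gh: "g \<cdot> h = Id C (Dom C m)"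
    using g(1-3) h(1-3) R by - (rule Mono_cancel[of m], simp_all)
  have "n \<cdot> h \<cdot> g = m \<cdot> g"
    by (rule Comp_extend[OF h(4)]) (use g(1-3) h(1-3) R in simp_all)
  also have "\<dots> = n \<cdot> Id C (Dom C n)" using g(4) R by simp
  finally have "h \<cdot> g = Id C (Dom C n)"
    using g(1-3) h(1-3) R by - (rule Mono_cancel[of n], simp_all)
  then have "h \<in> Iso C" using g(1-3) h(1-3) gh by (intro IsoI[of h g]) simp_all
  then show "subobj_equiv C m n"
    unfolding subobj_equiv_def by (intro conjI bexI[of _ h]) (use h(1-5) R in simp_all)
qed

end

section \<open>Toposes\<close>

context elementary_topos
begin

abbreviation \<Omega> where "\<Omega> \<equiv> Cod C tr"

abbreviation one where "one \<equiv> Dom C tr"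

lemma tr_Mor [simp]: "tr \<in> Mor C"
  using subobject_classifier by (simp add: is_subobject_classifier_def)

lemma terminal_one: "is_terminal C one"
  using subobject_classifier by (simp add: is_subobject_classifier_def)

definition bang where
  "bang X = (THE f. f \<in> hom C X one)"

lemma bang_simps [simp]:
  assumes "X \<in> Obj C"
  shows "bang X \<in> Mor C" "Dom C (bang X) = X" "Cod C (bang X) = one"
proof -
  have "\<exists>!f. f \<in> hom C X one"
    using terminal_one assms by (simp only: is_terminal_def)
  from theI'[OF this] have "bang X \<in> hom C X one"
    by (simp only: bang_def)
  then show "bang X \<in> Mor C" "Dom C (bang X) = X" "Cod C (bang X) = one" by simp_all
qed

lemma to_one_eq:
  assumes "f \<in> Mor C" "g \<in> Mor C" "Dom C f = Dom C g" "Cod C f = one" "Cod C g = one"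
  shows "f = g"
proof -
  have "\<exists>!f. f \<in> hom C (Dom C g) one"
    using terminal_one assms by (simp only: is_terminal_def Dom_in_Obj)
  then show ?thesis using assms by auto
qed

definition true where
  "true X = tr \<cdot> bang X"

lemma true_simps [simp]:
  assumes "X \<in> Obj C"
  shows "true X \<in> Mor C" "Dom C (true X) = X" "Cod C (true X) = \<Omega>"
  using assms by (simp_all add: true_def)

text \<open>A normal form: whatever reaches \<open>\<Omega>\<close> through \<open>tr\<close>
  depends on its domain alone, so morphisms into the terminal object vanish from later
  equations.\<close>

lemma tr_Comp [simp]:
  assumes "u \<in> Mor C" "Cod C u = one"
  shows "tr \<cdot> u = true (Dom C u)"
  using assms unfolding true_def by (metis to_one_eq bang_simps Dom_in_Obj)

lemma true_Comp [simp]: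
  assumes "f \<in> Mor C" "Cod C f = X"
  shows "true X \<cdot> f = true (Dom C f)"
proof -
  have "true X \<cdot> f = tr \<cdot> bang X \<cdot> f" using assms by (auto simp: true_def simp del: tr_Comp)
  also have "\<dots> = true (Dom C f)" using assms by auto
  finally show ?thesis .
qed

lemma tr_eq_true: "tr = true one"
  using tr_Comp[of "Id C one"] by (simp del: tr_Comp)

lemma tr_Mono: "tr \<in> Mono C"
  by (rule MonoI) (auto intro: to_one_eq)

section \<open>Characteristic morphisms and generalized elements\<close>

text \<open>The second leg of a cone over this square ends in the terminal object and carries no
  information, so the universal property only tests whether \<open>\<chi> \<cdot> x\<close> is
  true.\<close>

lemma pullback_tr_factors_iff:
  assumes pb: "is_pullback C \<chi> tr m u" and x: "x \<in> Mor C" "Cod C x = Dom C \<chi>"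
  shows "x \<sqsubseteq> m \<longleftrightarrow> \<chi> \<cdot> x = true (Dom C x)"
proof
  note D = is_pullbackD[OF pb]
  assume "x \<sqsubseteq> m"
  then obtain h where h: "h \<in> Mor C" "Dom C h = Dom C x" "Cod C h = Dom C m" "m \<cdot> h = x"
    by (rule factorsE)
  have "\<chi> \<cdot> m = true (Dom C m)" using D by simp
  then have "\<chi> \<cdot> m \<cdot> h = true (Dom C m) \<cdot> h"
    using D h by - (rule Comp_extend, simp_all)
  then show "\<chi> \<cdot> x = true (Dom C x)" using h by simp
next
  assume "\<chi> \<cdot> x = true (Dom C x)"
  then have eq: "\<chi> \<cdot> x = tr \<cdot> bang (Dom C x)"
    by (simp only: true_def)
  obtain h where "h \<in> Mor C" "Cod C h = Dom C m" "m \<cdot> h = x"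
    by (rule is_pullback_lift[OF pb x(1) _ _ x(2) _ eq]) (use x in simp_all)
  then show "x \<sqsubseteq> m" using is_pullbackD[OF pb] by (intro factorsI[of m h]) simp_all
qed

text \<open>Replaces the pullback square by a test on generalized elements. In the converse
  direction the mediating morphism is unique because \<open>m\<close> is monic, and it respects the
  leg into \<open>one\<close> by terminality.\<close>

lemma is_char_iff:
  assumes m: "m \<in> Mono C"
  shows "is_char C tr m \<chi> \<longleftrightarrow> \<chi> \<in> hom C (Cod C m) \<Omega> \<and>
    (\<forall>x \<in> Mor C. Cod C x = Cod C m \<longrightarrow> (\<chi> \<cdot> x = true (Dom C x) \<longleftrightarrow> x \<sqsubseteq> m))"
    (is "?L \<longleftrightarrow> ?R")
proof
  assume ?L
  then show ?R
    using pullback_tr_factors_iff by (auto simp: is_char_def)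
next
  assume R: ?R
  then have chi: "\<chi> \<in> Mor C" "Dom C \<chi> = Cod C m" "Cod C \<chi> = \<Omega>"
    and iff: "\<And>x. x \<in> Mor C \<Longrightarrow> Cod C x = Cod C m \<Longrightarrow> \<chi> \<cdot> x = true (Dom C x) \<longleftrightarrow> x \<sqsubseteq> m"
    by auto
  have "is_pullback C \<chi> tr m (bang (Dom C m))"
    unfolding is_pullback_def
  proof (intro conjI allI ballI impI)
    show "\<chi> \<cdot> m = tr \<cdot> bang (Dom C m)"
      using iff[of m] m factors_refl[of m] by simp
  next
    fix X a b
    assume a: "a \<in> hom C X (Dom C \<chi>)" and b: "b \<in> hom C X one" and eq: "\<chi> \<cdot> a = tr \<cdot> b"
    then have "a \<sqsubseteq> m" using iff[of a] chi by simp
    then obtain h where h: "h \<in> Mor C" "Dom C h = Dom C a" "Cod C h = Dom C m" "m \<cdot> h = a"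
      by (rule factorsE)
    show "\<exists>!h. h \<in> hom C X (Dom C m) \<and> m \<cdot> h = a \<and> bang (Dom C m) \<cdot> h = b"
    proof (rule ex1I[of _ h])
      show "h \<in> hom C X (Dom C m) \<and> m \<cdot> h = a \<and> bang (Dom C m) \<cdot> h = b"
        using h a b m by (auto intro!: to_one_eq)
    next
      fix h'
      assume "h' \<in> hom C X (Dom C m) \<and> m \<cdot> h' = a \<and> bang (Dom C m) \<cdot> h' = b"
      then show "h' = h" using h a by - (rule Mono_cancel[OF m], simp_all)
    qed
  qed (use m chi in simp_all)
  then show ?L using chi by (auto simp: is_char_def)
qed

lemma is_char_char_mor: "m \<in> Mono C \<Longrightarrow> is_char C tr m (char_mor C tr m)"
  using subobject_classifier unfolding is_subobject_classifier_def char_mor_def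
  by (blast intro: theI')

lemma char_mor_simps [simp]:
  assumes "m \<in> Mono C"
  shows "char_mor C tr m \<in> Mor C" "Dom C (char_mor C tr m) = Cod C m"
    "Cod C (char_mor C tr m) = \<Omega>"
  using is_char_char_mor[OF assms] is_char_iff[OF assms] by simp_all

lemma char_mor_true_iff:
  assumes "m \<in> Mono C" "x \<in> Mor C" "Cod C x = Cod C m"
  shows "char_mor C tr m \<cdot> x = true (Dom C x) \<longleftrightarrow> x \<sqsubseteq> m"
  using is_char_char_mor[OF assms(1)] is_char_iff[OF assms(1)] assms by simp

text \<open>Every predicate classifies the subobject that it defines. The last clause names the
  representative chosen by \<open>inv_image\<close>, which is the one that \<open>closure_op\<close>
  returns.\<close>

lemma true_kernel:
  assumes "\<chi> \<in> Mor C" "Cod C \<chi> = \<Omega>"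
  obtains m where "m \<in> Mono C" "Cod C m = Dom C \<chi>" "is_char C tr m \<chi>" "inv_image C \<chi> tr = m"
proof -
  have "\<exists>p. \<exists>q. is_pullback C \<chi> tr p q" using pullbacks assms by simp
  then have "\<exists>q. is_pullback C \<chi> tr (inv_image C \<chi> tr) q"
    unfolding inv_image_def by (rule someI_ex)
  then obtain q where q: "is_pullback C \<chi> tr (inv_image C \<chi> tr) q" ..
  show ?thesis
  proof (rule that[OF _ _ _ refl])
    show "inv_image C \<chi> tr \<in> Mono C" using q tr_Mono by (rule is_pullback_Mono)
    show "Cod C (inv_image C \<chi> tr) = Dom C \<chi>" using is_pullbackD[OF q] by simp
    then show "is_char C tr (inv_image C \<chi> tr) \<chi>"
      using q assms by (auto simp: is_char_def)
  qed
qed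

text \<open>Extensionality for predicates: by the test, both morphisms classify the subobject
  defined by \<open>\<chi>\<close>, and characteristic morphisms are unique. The equations for
  \<open>k \<cdot> k\<close> and for conjunction are proved this way.\<close>

lemma Omega_ext:
  assumes chi: "\<chi> \<in> Mor C" "Cod C \<chi> = \<Omega>" "\<chi>' \<in> Mor C" "Cod C \<chi>' = \<Omega>" "Dom C \<chi>' = Dom C \<chi>"
    and iff: "\<And>x. x \<in> Mor C \<Longrightarrow> Cod C x = Dom C \<chi> \<Longrightarrow>
      \<chi> \<cdot> x = true (Dom C x) \<longleftrightarrow> \<chi>' \<cdot> x = true (Dom C x)"
  shows "\<chi> = \<chi>'"
proof -
  obtain m where m: "m \<in> Mono C" "Cod C m = Dom C \<chi>" "is_char C tr m \<chi>"
    using chi by (elim true_kernel)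
  then have "is_char C tr m \<chi>'"
    using chi iff by (simp add: is_char_iff)
  moreover have "\<exists>!\<chi>. is_char C tr m \<chi>"
    using subobject_classifier m(1) by (simp add: is_subobject_classifier_def)
  ultimately show ?thesis using m(3) by blast
qed

lemma closure_op_simps:
  assumes m: "m \<in> Mono C" and k: "k \<in> Mor C" "Dom C k = \<Omega>" "Cod C k = \<Omega>"
  shows "closure_op C tr k m \<in> Mono C" "Cod C (closure_op C tr k m) = Cod C m"
    and "x \<in> Mor C \<Longrightarrow> Cod C x = Cod C m \<Longrightarrow>
      x \<sqsubseteq> closure_op C tr k m \<longleftrightarrow> k \<cdot> char_mor C tr m \<cdot> x = true (Dom C x)"
proof -
  let ?\<chi> = "k \<cdot> char_mor C tr m"
  have "?\<chi> \<in> Mor C" "Cod C ?\<chi> = \<Omega>" using m k by simp_all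
  then obtain c where c: "c \<in> Mono C" "Cod C c = Dom C ?\<chi>" "is_char C tr c ?\<chi>"
    "inv_image C ?\<chi> tr = c"
    by (rule true_kernel)
  then show "closure_op C tr k m \<in> Mono C" "Cod C (closure_op C tr k m) = Cod C m"
    using m k by (simp_all add: closure_op_def)
  show "x \<sqsubseteq> closure_op C tr k m \<longleftrightarrow> k \<cdot> char_mor C tr m \<cdot> x = true (Dom C x)"
    if "x \<in> Mor C" "Cod C x = Cod C m"
    using c m k that by (simp add: closure_op_def is_char_iff)
qed

subsection \<open>Products and equalizers\<close>

text \<open>A pullback over the terminal object is a product, so the arbitrary choice in
  \<open>prod_cone\<close> does pick a product.\<close>

lemma is_product_prod_cone:
  assumes "A \<in> Obj C" "B \<in> Obj C"
  shows "is_product C A B (prod_cone C A B)"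
proof -
  obtain p q where pb: "is_pullback C (bang A) (bang B) p q"
    using pullbacks[of "bang A" "bang B"] assms by auto
  note D = is_pullbackD[OF pb]
  have "is_product C A B (Dom C p, p, q)"
    unfolding is_product_def prod.case
  proof (intro conjI allI ballI)
    fix X f g
    assume fg: "f \<in> hom C X A" "g \<in> hom C X B"
    then have "bang A \<cdot> f = bang B \<cdot> g" using assms by (intro to_one_eq) simp_all
    then show "\<exists>!h. h \<in> hom C X (Dom C p) \<and> p \<cdot> h = f \<and> q \<cdot> h = g"
      using fg assms by (intro is_pullback_ex1[OF pb]) simp_all
  qed (use D assms in simp_all)
  then show ?thesis
    unfolding prod_cone_def by (rule someI)
qed

lemma is_product_chosen:
  assumes "A \<in> Obj C" "B \<in> Obj C"
  shows "is_product C A B (prod_obj C A B, proj1 C A B, proj2 C A B)"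
  using is_product_prod_cone[OF assms] by (simp add: prod_obj_def proj1_def proj2_def)

lemma prod_simps [simp]:
  assumes "A \<in> Obj C" "B \<in> Obj C"
  shows "prod_obj C A B \<in> Obj C"
    "proj1 C A B \<in> Mor C" "Dom C (proj1 C A B) = prod_obj C A B" "Cod C (proj1 C A B) = A"
    "proj2 C A B \<in> Mor C" "Dom C (proj2 C A B) = prod_obj C A B" "Cod C (proj2 C A B) = B"
  using is_product_chosen[OF assms] by (simp_all add: is_product_def)

definition pair where
  "pair f g = (THE h. h \<in> hom C (Dom C f) (prod_obj C (Cod C f) (Cod C g)) \<and>
     proj1 C (Cod C f) (Cod C g) \<cdot> h = f \<and> proj2 C (Cod C f) (Cod C g) \<cdot> h = g)"

lemma pair_ex1:
  assumes "f \<in> Mor C" "g \<in> Mor C" "Dom C f = Dom C g"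
  shows "\<exists>!h. h \<in> hom C (Dom C f) (prod_obj C (Cod C f) (Cod C g)) \<and>
     proj1 C (Cod C f) (Cod C g) \<cdot> h = f \<and> proj2 C (Cod C f) (Cod C g) \<cdot> h = g"
  using is_product_chosen[of "Cod C f" "Cod C g"] assms by (simp add: is_product_def)

lemma pair_simps [simp]:
  assumes "f \<in> Mor C" "g \<in> Mor C" "Dom C f = Dom C g"
  shows "pair f g \<in> Mor C" "Dom C (pair f g) = Dom C f"
    "Cod C (pair f g) = prod_obj C (Cod C f) (Cod C g)"
  using theI'[OF pair_ex1[OF assms]] unfolding pair_def[symmetric] by simp_all

lemma proj_pair [simp]:
  assumes "f \<in> Mor C" "g \<in> Mor C" "Dom C f = Dom C g" "Cod C f = A" "Cod C g = B"
  shows "proj1 C A B \<cdot> pair f g = f" "proj2 C A B \<cdot> pair f g = g"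
  using theI'[OF pair_ex1[OF assms(1-3)]] assms(4,5) unfolding pair_def[symmetric] by simp_all

lemma proj_pair_Comp [simp]:
  assumes "f \<in> Mor C" "g \<in> Mor C" "Dom C f = Dom C g" "Cod C f = A" "Cod C g = B"
    "x \<in> Mor C" "Cod C x = Dom C f"
  shows "proj1 C A B \<cdot> pair f g \<cdot> x = f \<cdot> x" "proj2 C A B \<cdot> pair f g \<cdot> x = g \<cdot> x"
  using Comp_extend[OF proj_pair(1)[OF assms(1-5)]]
    Comp_extend[OF proj_pair(2)[OF assms(1-5)]] assms by auto

lemma prod_ext:
  assumes "h \<in> Mor C" "h' \<in> Mor C" "Dom C h = Dom C h'" "A \<in> Obj C" "B \<in> Obj C"
    "Cod C h = prod_obj C A B" "Cod C h' = prod_obj C A B"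
    "proj1 C A B \<cdot> h = proj1 C A B \<cdot> h'" "proj2 C A B \<cdot> h = proj2 C A B \<cdot> h'"
  shows "h = h'"
proof -
  have "\<exists>!k. k \<in> hom C (Dom C h) (prod_obj C A B) \<and>
      proj1 C A B \<cdot> k = proj1 C A B \<cdot> h \<and> proj2 C A B \<cdot> k = proj2 C A B \<cdot> h"
    using is_product_chosen[of A B] assms by (simp add: is_product_def)
  then show ?thesis using assms by auto
qed

lemma pair_Comp [simp]:
  assumes "f \<in> Mor C" "g \<in> Mor C" "Dom C f = Dom C g" "x \<in> Mor C" "Cod C x = Dom C f"
  shows "pair f g \<cdot> x = pair (f \<cdot> x) (g \<cdot> x)"
  using assms by - (rule prod_ext[of _ _ "Cod C f" "Cod C g"], simp_all)

text \<open>Turns product maps into pairings, after which \<open>pair_Comp\<close> and the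
  projection rules compute composites.\<close>

lemma prod_map_eq [simp]:
  assumes "f \<in> Mor C" "g \<in> Mor C"
  shows "prod_map C f g =
    pair (f \<cdot> proj1 C (Dom C f) (Dom C g)) (g \<cdot> proj2 C (Dom C f) (Dom C g))"
  unfolding prod_map_def
proof (rule the_equality)
  fix h
  assume h: "h \<in> hom C (prod_obj C (Dom C f) (Dom C g)) (prod_obj C (Cod C f) (Cod C g)) \<and>
     proj1 C (Cod C f) (Cod C g) \<cdot> h = f \<cdot> proj1 C (Dom C f) (Dom C g) \<and>
     proj2 C (Cod C f) (Cod C g) \<cdot> h = g \<cdot> proj2 C (Dom C f) (Dom C g)"
  show "h = pair (f \<cdot> proj1 C (Dom C f) (Dom C g)) (g \<cdot> proj2 C (Dom C f) (Dom C g))"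
    by (rule prod_ext[of _ _ "Cod C f" "Cod C g"]) (use h assms in auto)
qed (use assms in simp)

text \<open>The pullback of the graphs of \<open>g\<close> and \<open>h\<close>: the first
  components force both legs to be the same \<open>p\<close>, and the second components then say
  \<open>g \<cdot> p = h \<cdot> p\<close>.\<close>

lemma equalizer:
  assumes g: "g \<in> Mor C" "h \<in> Mor C" "Dom C g = Dom C h" "Cod C g = Cod C h"
  obtains e where "e \<in> Mono C" "Cod C e = Dom C g"
    "\<And>x. x \<in> Mor C \<Longrightarrow> Cod C x = Dom C g \<Longrightarrow> x \<sqsubseteq> e \<longleftrightarrow> g \<cdot> x = h \<cdot> x"
proof -
  let ?I = "Id C (Dom C g)" and ?A = "Dom C g" and ?B = "Cod C g"
  obtain p q where pb: "is_pullback C (pair ?I g) (pair ?I h) p q"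
    using pullbacks[of "pair ?I g" "pair ?I h"] g by auto
  note D = is_pullbackD[OF pb]
  have pq: "p \<in> Mor C" "q \<in> Mor C" "Cod C p = ?A" "Cod C q = ?A" "Dom C q = Dom C p"
    using D(4-8) g by simp_all
  have "p = proj1 C ?A ?B \<cdot> pair ?I g \<cdot> p" using pq g by simp
  also have "\<dots> = proj1 C ?A ?B \<cdot> pair ?I h \<cdot> q" by (simp only: D(9))
  also have "\<dots> = q" using pq g by simp
  finally have eq: "p = q" .
  have "g \<cdot> p = proj2 C ?A ?B \<cdot> pair ?I g \<cdot> p" using pq g by simp
  also have "\<dots> = proj2 C ?A ?B \<cdot> pair ?I h \<cdot> q" by (simp only: D(9))
  also have "\<dots> = h \<cdot> p" using pq g eq by simp
  finally have gp: "g \<cdot> p = h \<cdot> p" .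
  show ?thesis
  proof (rule that[of p])
    show "p \<in> Mono C"
    proof (rule MonoI)
      fix a b
      assume "a \<in> Mor C" "b \<in> Mor C" "Dom C a = Dom C b" "Cod C a = Dom C p"
        "Cod C b = Dom C p" "p \<cdot> a = p \<cdot> b"
      then show "a = b" unfolding eq by - (rule is_pullback_unique[OF pb], simp_all add: eq)
    qed (rule pq)
  next
    fix x
    assume x: "x \<in> Mor C" "Cod C x = Dom C g"
    show "x \<sqsubseteq> p \<longleftrightarrow> g \<cdot> x = h \<cdot> x"
    proof
      assume "x \<sqsubseteq> p"
      then obtain y where y: "y \<in> Mor C" "Dom C y = Dom C x" "Cod C y = Dom C p" "p \<cdot> y = x"
        by (rule factorsE)
      have "g \<cdot> p \<cdot> y = h \<cdot> p \<cdot> y"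
        by (rule Comp_eq_extend[OF gp]) (use y(1-3) pq g in simp_all)
      then show "g \<cdot> x = h \<cdot> x" using y by simp
    next
      assume "g \<cdot> x = h \<cdot> x"
      then have "Cod C x = Dom C (pair ?I g)" "Cod C x = Dom C (pair ?I h)"
        "pair ?I g \<cdot> x = pair ?I h \<cdot> x"
        using x g by simp_all
      then obtain y where "y \<in> Mor C" "Cod C y = Dom C p" "p \<cdot> y = x"
        by (rule is_pullback_lift[OF pb x(1) x(1) refl])
      then show "x \<sqsubseteq> p" using pq by (blast intro: factorsI)
    qed
  qed (rule pq)
qed

subsection \<open>Images\<close>

lemma is_exponentialD:
  assumes "is_exponential C A B P ev"
  shows "P \<in> Obj C" "ev \<in> Mor C" "Dom C ev = prod_obj C P A" "Cod C ev = B"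
  using assms unfolding is_exponential_def hom_iff by - (elim conjE; assumption)+

lemma is_exponential_ex1:
  assumes "is_exponential C A B P ev" and "X \<in> Obj C" "f \<in> hom C (prod_obj C X A) B"
  shows "\<exists>!g. g \<in> hom C X P \<and> ev \<cdot> prod_map C g (Id C A) = f"
  using assms unfolding is_exponential_def by blast

lemma is_exponential_curry:
  assumes "is_exponential C A B P ev"
    and "X \<in> Obj C" "f \<in> Mor C" "Dom C f = prod_obj C X A" "Cod C f = B"
  obtains g where "g \<in> Mor C" "Dom C g = X" "Cod C g = P" "ev \<cdot> prod_map C g (Id C A) = f"
proof -
  have "\<exists>!g. g \<in> hom C X P \<and> ev \<cdot> prod_map C g (Id C A) = f"
    using assms by (intro is_exponential_ex1) simp_all
  then obtain g where "g \<in> hom C X P \<and> ev \<cdot> prod_map C g (Id C A) = f"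
    by (rule ex1E)
  then show thesis by (intro that[of g]) (simp_all del: prod_map_eq)
qed

lemma is_exponential_unique:
  assumes ex: "is_exponential C A B P ev" and A: "A \<in> Obj C"
    and g: "g \<in> Mor C" "h \<in> Mor C" "Dom C g = Dom C h" "Cod C g = P" "Cod C h = P"
    and eq: "ev \<cdot> prod_map C g (Id C A) = ev \<cdot> prod_map C h (Id C A)"
  shows "g = h"
proof -
  have "\<exists>!k. k \<in> hom C (Dom C h) P \<and> ev \<cdot> prod_map C k (Id C A) = ev \<cdot> prod_map C h (Id C A)"
    using is_exponentialD[OF ex] g A by (intro is_exponential_ex1[OF ex]) simp_all
  then show ?thesis
    by (rule ex1E) (metis g eq hom_iff)
qed

text \<open>\<open>w\<close> is the subobject of those \<open>x\<close> for which \<phi>(x, a) holds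
  for all \<open>a\<close> in \<open>A\<close>. It is the equalizer of two morphisms from
  \<open>X\<close> to the power object of \<open>A\<close>: the transpose of \<open>\<phi>\<close>
  and the transpose of the constant true.\<close>

lemma universal_quantifier:
  assumes X: "X \<in> Obj C" "A \<in> Obj C"
    and phi: "\<phi> \<in> Mor C" "Dom C \<phi> = prod_obj C X A" "Cod C \<phi> = \<Omega>"
  obtains w where "w \<in> Mono C" "Cod C w = X"
    "\<And>x. x \<in> Mor C \<Longrightarrow> Cod C x = X \<Longrightarrow>
      x \<sqsubseteq> w \<longleftrightarrow> \<phi> \<cdot> prod_map C x (Id C A) = true (prod_obj C (Dom C x) A)"
proof -
  obtain P ev where ex: "is_exponential C A \<Omega> P ev"
    using exponentials[of A \<Omega>] X by auto
  note ev = is_exponentialD[OF ex]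
  obtain g where g: "g \<in> Mor C" "Dom C g = X" "Cod C g = P" "ev \<cdot> prod_map C g (Id C A) = \<phi>"
    using X(1) phi by (rule is_exponential_curry[OF ex])
  obtain h where h: "h \<in> Mor C" "Dom C h = X" "Cod C h = P"
    "ev \<cdot> prod_map C h (Id C A) = true (prod_obj C X A)"
    by (rule is_exponential_curry[OF ex X(1), of "true (prod_obj C X A)"]) (use X in simp_all)
  obtain w where w: "w \<in> Mono C" "Cod C w = Dom C g"
    "\<And>x. x \<in> Mor C \<Longrightarrow> Cod C x = Dom C g \<Longrightarrow> x \<sqsubseteq> w \<longleftrightarrow> g \<cdot> x = h \<cdot> x"
    using g h by (elim equalizer[of g h]) auto
  show ?thesis
  proof (rule that[of w])
    fix x
    assume x: "x \<in> Mor C" "Cod C x = X"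
    \<comment> \<open>Naturality of transposition in \<open>X\<close>: restricting the transpose
      along \<open>x\<close> transposes the restricted predicate.\<close>
    have sub: "ev \<cdot> prod_map C (f \<cdot> x) (Id C A) = (ev \<cdot> prod_map C f (Id C A)) \<cdot> prod_map C x (Id C A)"
      if "f \<in> Mor C" "Dom C f = X" "Cod C f = P" for f
      using that x X ev by simp
    have "g \<cdot> x = h \<cdot> x \<longleftrightarrow>
        ev \<cdot> prod_map C (g \<cdot> x) (Id C A) = ev \<cdot> prod_map C (h \<cdot> x) (Id C A)"
    proof
      assume eq: "ev \<cdot> prod_map C (g \<cdot> x) (Id C A) = ev \<cdot> prod_map C (h \<cdot> x) (Id C A)"
      show "g \<cdot> x = h \<cdot> x"
        by (rule is_exponential_unique[OF ex X(2) _ _ _ _ _ eq]) (use g(1-3) h(1-3) x in simp_all)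
    qed simp
    also have "\<dots> \<longleftrightarrow> \<phi> \<cdot> prod_map C x (Id C A) = true (prod_obj C X A) \<cdot> prod_map C x (Id C A)"
      using sub[of g] sub[of h] g h by (simp only:)
    also have "true (prod_obj C X A) \<cdot> prod_map C x (Id C A) = true (prod_obj C (Dom C x) A)"
      using x X by simp
    finally show "x \<sqsubseteq> w \<longleftrightarrow> \<phi> \<cdot> prod_map C x (Id C A) = true (prod_obj C (Dom C x) A)"
      using w(3)[of x] x g by simp
  qed (use w g in simp_all)
qed

text \<open>The image is the internal intersection of all subobjects containing it: \<open>w\<close> below is the
  subobject of the power object of \<open>Cod C f\<close> formed by the predicates true along \<open>f\<close>.\<close>

lemma least_subobject:
  assumes f: "f \<in> Mor C"
  obtains i where "i \<in> Mono C" "f \<sqsubseteq> i" "\<And>n. n \<in> Mono C \<Longrightarrow> f \<sqsubseteq> n \<Longrightarrow> i \<sqsubseteq> n"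
proof -
  let ?A = "Dom C f" and ?B = "Cod C f"
  have AB: "?A \<in> Obj C" "?B \<in> Obj C" using f by simp_all
  obtain P ev where ex: "is_exponential C ?B \<Omega> P ev"
    using exponentials[of ?B \<Omega>] AB by auto
  note ev = is_exponentialD[OF ex]
  \<comment> \<open>In elements, \<phi>(p, a) says that \<open>f\<close> applied to \<open>a\<close>
    satisfies the predicate \<open>p\<close>.\<close>
  let ?\<phi> = "ev \<cdot> prod_map C (Id C P) f"
  have phi: "?\<phi> \<in> Mor C" "Dom C ?\<phi> = prod_obj C P ?A" "Cod C ?\<phi> = \<Omega>"
    using ev f by simp_all
  obtain w where w: "w \<in> Mono C" "Cod C w = P"
    "\<And>x. x \<in> Mor C \<Longrightarrow> Cod C x = P \<Longrightarrow>
      x \<sqsubseteq> w \<longleftrightarrow> ?\<phi> \<cdot> prod_map C x (Id C ?A) = true (prod_obj C (Dom C x) ?A)"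
    using universal_quantifier[OF ev(1) AB(1) phi] by blast
  let ?W = "Dom C w"
  have wM: "w \<in> Mor C" "?W \<in> Obj C" using w by simp_all
  \<comment> \<open>In elements, \<psi>(b, s) says that \<open>b\<close> satisfies the member
    \<open>s\<close> of the family \<open>w\<close>. Quantifying over all \<open>s\<close> gives the
    intersection \<open>i\<close>.\<close>
  let ?\<psi> = "ev \<cdot> pair (w \<cdot> proj2 C ?B ?W) (proj1 C ?B ?W)"
  have psi: "?\<psi> \<in> Mor C" "Dom C ?\<psi> = prod_obj C ?B ?W" "Cod C ?\<psi> = \<Omega>"
    using ev wM w f by simp_all
  obtain i where i: "i \<in> Mono C" "Cod C i = ?B"
    "\<And>x. x \<in> Mor C \<Longrightarrow> Cod C x = ?B \<Longrightarrow>
      x \<sqsubseteq> i \<longleftrightarrow> ?\<psi> \<cdot> prod_map C x (Id C ?W) = true (prod_obj C (Dom C x) ?W)"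
    using universal_quantifier[OF AB(2) wM(2) psi] by blast
  show ?thesis
  proof (rule that[of i])
    \<comment> \<open>The swap of factors: that every member of \<open>w\<close> holds along
      \<open>f\<close> is known over \<open>?W\<close> x \<open>?A\<close>, whereas \<open>i\<close>
      asks for it over \<open>?A\<close> x \<open>?W\<close>.\<close>
    let ?s = "pair (proj2 C ?A ?W) (proj1 C ?A ?W)"
    have "?\<phi> \<cdot> prod_map C w (Id C ?A) = true (prod_obj C ?W ?A)"
      using w(3)[of w] factors_refl w by simp
    then have "(?\<phi> \<cdot> prod_map C w (Id C ?A)) \<cdot> ?s = true (prod_obj C ?W ?A) \<cdot> ?s"
      by simp
    then have "?\<psi> \<cdot> prod_map C f (Id C ?W) = true (prod_obj C ?A ?W)"
      using w(1,2) ev f wM AB by simp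
    then show "f \<sqsubseteq> i" using i(3)[of f] f by simp
  next
    fix n
    assume n: "n \<in> Mono C" "f \<sqsubseteq> n"
    let ?u = "char_mor C tr n"
    have cod: "Cod C n = ?B" using n(2) by (rule factorsE) simp
    have uf: "?u \<cdot> f = true ?A" using char_mor_true_iff[OF n(1) f] n cod by simp
    \<comment> \<open>\<open>g\<close> is the name of \<open>n\<close>, the global element of the
      power object that corresponds to its characteristic morphism. As \<open>n\<close> contains
      \<open>f\<close>, this element belongs to \<open>w\<close>.\<close>
    obtain g where g: "g \<in> Mor C" "Dom C g = one" "Cod C g = P"
      "ev \<cdot> prod_map C g (Id C ?B) = ?u \<cdot> proj2 C one ?B"
      by (rule is_exponential_curry[OF ex, of one "?u \<cdot> proj2 C one ?B"])
        (use n(1) AB cod in simp_all)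
    have uf': "?u \<cdot> f \<cdot> proj2 C one ?A = true (prod_obj C one ?A)"
      using Comp_extend[OF uf, of "proj2 C one ?A"] f n(1) cod by simp
    have "?\<phi> \<cdot> prod_map C g (Id C ?A) = (ev \<cdot> prod_map C g (Id C ?B)) \<cdot> prod_map C (Id C one) f"
      using g(1-3) f ev by simp
    also have "\<dots> = (?u \<cdot> proj2 C one ?B) \<cdot> prod_map C (Id C one) f" by (simp only: g(4))
    also have "\<dots> = true (prod_obj C one ?A)" using uf' f n cod by simp
    finally have "g \<sqsubseteq> w" using w(3)[OF g(1,3)] g(2) by (simp only:)
    then obtain g' where g': "g' \<in> Mor C" "Dom C g' = one" "Cod C g' = ?W" "w \<cdot> g' = g"
      using g(2) by (elim factorsE) (simp only:)
    let ?I = "Dom C i"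
    have iM: "i \<in> Mor C" "?I \<in> Obj C" using i by simp_all
    have wg: "w \<cdot> g' \<cdot> bang ?I = g \<cdot> bang ?I"
      by (rule Comp_extend[OF g'(4)]) (use g'(1-3) wM iM in simp_all)
    \<comment> \<open>Instantiates the quantifier that defines \<open>i\<close> at the member
      \<open>g'\<close> of the family, that is, at \<open>n\<close> itself.\<close>
    let ?t = "pair (Id C ?I) (g' \<cdot> bang ?I)"
    have "?\<psi> \<cdot> prod_map C i (Id C ?W) = true (prod_obj C ?I ?W)"
      using i(3)[of i] factors_refl i by simp
    then have "(?\<psi> \<cdot> prod_map C i (Id C ?W)) \<cdot> ?t = true (prod_obj C ?I ?W) \<cdot> ?t"
      by simp
    then have ev_gi: "ev \<cdot> pair (g \<cdot> bang ?I) i = true ?I"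
      using g'(1-3) wg wM w(2) iM i(2) ev f by simp
    have "?u \<cdot> i = (?u \<cdot> proj2 C one ?B) \<cdot> pair (bang ?I) i"
      using iM i(2) n cod AB by simp
    also have "\<dots> = (ev \<cdot> prod_map C g (Id C ?B)) \<cdot> pair (bang ?I) i" by (simp only: g(4))
    also have "\<dots> = true ?I" using ev_gi g(1-3) ev iM i(2) AB by simp
    finally show "i \<sqsubseteq> n" using char_mor_true_iff[OF n(1) iM(1)] i(2) cod by simp
  qed (rule i)
qed

text \<open>If \<open>g \<cdot> e = h \<cdot> e\<close>, then \<open>e\<close> factors through the
  equalizer \<open>q\<close> of \<open>g\<close> and \<open>h\<close>, so \<open>i \<cdot> q\<close>
  still contains \<open>f\<close>. Leastness of \<open>i\<close> splits \<open>q\<close>, whence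
  \<open>g = h\<close>.\<close>

lemma epi_mono_factorization:
  assumes "f \<in> Mor C"
  obtains i e where "i \<in> Mono C" "e \<in> Epi C" "Dom C i = Cod C e" "f = i \<cdot> e"
proof -
  obtain i where i: "i \<in> Mono C" "f \<sqsubseteq> i" and least: "\<And>n. n \<in> Mono C \<Longrightarrow> f \<sqsubseteq> n \<Longrightarrow> i \<sqsubseteq> n"
    using least_subobject[OF assms] by blast
  obtain e where e: "e \<in> Mor C" "Dom C e = Dom C f" "Cod C e = Dom C i" "i \<cdot> e = f"
    using i(2) by (rule factorsE)
  have "e \<in> Epi C"
  proof (rule EpiI[OF e(1)])
    fix g h
    assume gh: "g \<in> Mor C" "h \<in> Mor C" "Cod C g = Cod C h"
      "Dom C g = Cod C e" "Dom C h = Cod C e" "g \<cdot> e = h \<cdot> e"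
    obtain q where q: "q \<in> Mono C" "Cod C q = Dom C g"
      "\<And>x. x \<in> Mor C \<Longrightarrow> Cod C x = Dom C g \<Longrightarrow> x \<sqsubseteq> q \<longleftrightarrow> g \<cdot> x = h \<cdot> x"
      using gh by (elim equalizer[of g h]) auto
    have "e \<sqsubseteq> q" using q(3)[of e] gh e by simp
    then obtain d where d: "d \<in> Mor C" "Dom C d = Dom C e" "Cod C d = Dom C q" "q \<cdot> d = e"
      by (rule factorsE)
    have iq: "i \<cdot> q \<in> Mono C" using i(1) q(1,2) gh(4) e by (intro Mono_Comp) simp_all
    have "(i \<cdot> q) \<cdot> d = f" using d e q(1,2) gh(4) i(1) by simp
    then have "f \<sqsubseteq> i \<cdot> q" using iq d q(1,2) gh(4) i(1) e by (intro factorsI[of _ d]) simp_all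
    then have "i \<sqsubseteq> i \<cdot> q" using iq least by blast
    then obtain t where t: "t \<in> Mor C" "Dom C t = Dom C i" "Cod C t = Dom C (i \<cdot> q)"
      "(i \<cdot> q) \<cdot> t = i"
      by (rule factorsE)
    have "i \<cdot> q \<cdot> t = i \<cdot> Id C (Dom C i)" using t q(1,2) gh(4) i(1) e by simp
    then have "q \<cdot> t = Id C (Dom C i)"
      using t q(1,2) gh(4) i(1) e by - (rule Mono_cancel[OF i(1)], simp_all)
    then have "Id C (Dom C i) \<sqsubseteq> q"
      using t q(1,2) gh(4) i(1) e by (intro factorsI[of q t]) simp_all
    then show "g = h" using q(3)[of "Id C (Dom C i)"] gh e i(1) by simp
  qed
  then show ?thesis using that[of i e] i e by simp
qed

text \<open>\<open>n\<close> is the equalizer of its characteristic morphism and the constant true.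
  Factoring through \<open>n\<close> is thus an equation, from which the epimorphism
  \<open>e\<close> cancels.\<close>

lemma Epi_lift:
  assumes e: "e \<in> Epi C" and n: "n \<in> Mono C" and v: "v \<in> Mor C" "Dom C v = Cod C e"
    and ve: "v \<cdot> e \<sqsubseteq> n"
  shows "v \<sqsubseteq> n"
proof -
  have cod: "Cod C v = Cod C n" using ve e v by (auto elim: factorsE)
  have "char_mor C tr n \<cdot> v \<cdot> e = true (Dom C e)"
    using char_mor_true_iff[OF n, of "v \<cdot> e"] ve e v cod by simp
  then have "(char_mor C tr n \<cdot> v) \<cdot> e = true (Dom C v) \<cdot> e"
    using n v e cod by simp
  then have "char_mor C tr n \<cdot> v = true (Dom C v)"
    using n v e cod by - (rule Epi_cancel[OF e], simp_all)
  then show ?thesis using char_mor_true_iff[OF n v(1) cod] by simp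
qed

section \<open>Products of morphisms\<close>

text \<open>Exhibits \<open>f\<close> x 1 as a pullback of \<open>f\<close>, so a pullback-stable
  class contains it together with \<open>f\<close>.\<close>

lemma pullback_prod_map_left:
  assumes "f \<in> Mor C" "B \<in> Obj C"
  shows "is_pullback C f (proj1 C (Cod C f) B) (proj1 C (Dom C f) B) (prod_map C f (Id C B))"
  unfolding is_pullback_def
proof (intro conjI allI ballI impI)
  fix X a b
  assume ab: "a \<in> hom C X (Dom C f)" "b \<in> hom C X (Dom C (proj1 C (Cod C f) B))"
    "f \<cdot> a = proj1 C (Cod C f) B \<cdot> b"
  let ?h = "pair a (proj2 C (Cod C f) B \<cdot> b)"
  show "\<exists>!h. h \<in> hom C X (Dom C (proj1 C (Dom C f) B)) \<and> proj1 C (Dom C f) B \<cdot> h = a \<and>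
      prod_map C f (Id C B) \<cdot> h = b"
  proof (rule ex1I[of _ ?h])
    have "prod_map C f (Id C B) \<cdot> ?h = b"
      by (rule prod_ext[of _ _ "Cod C f" B]) (use ab assms in simp_all)
    then show "?h \<in> hom C X (Dom C (proj1 C (Dom C f) B)) \<and> proj1 C (Dom C f) B \<cdot> ?h = a \<and>
        prod_map C f (Id C B) \<cdot> ?h = b"
      using ab assms by (simp del: prod_map_eq)
  next
    fix h
    assume "h \<in> hom C X (Dom C (proj1 C (Dom C f) B)) \<and> proj1 C (Dom C f) B \<cdot> h = a \<and>
        prod_map C f (Id C B) \<cdot> h = b"
    then have h: "h \<in> hom C X (Dom C (proj1 C (Dom C f) B))"
      and ha: "proj1 C (Dom C f) B \<cdot> h = a" and hb: "prod_map C f (Id C B) \<cdot> h = b"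
      by - (elim conjE; assumption)+
    have "proj2 C (Dom C f) B \<cdot> h = proj2 C (Cod C f) B \<cdot> prod_map C f (Id C B) \<cdot> h"
      using h assms by simp
    also have "\<dots> = proj2 C (Cod C f) B \<cdot> b" by (simp only: hb)
    finally show "h = ?h"
      using h ha ab(1,2) assms by - (rule prod_ext[of _ _ "Dom C f" B], simp_all)
  qed
qed (use assms in simp_all)

lemma pullback_prod_map_right:
  assumes "f \<in> Mor C" "B \<in> Obj C"
  shows "is_pullback C f (proj2 C B (Cod C f)) (proj2 C B (Dom C f)) (prod_map C (Id C B) f)"
  unfolding is_pullback_def
proof (intro conjI allI ballI impI)
  fix X a b
  assume ab: "a \<in> hom C X (Dom C f)" "b \<in> hom C X (Dom C (proj2 C B (Cod C f)))"
    "f \<cdot> a = proj2 C B (Cod C f) \<cdot> b"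
  let ?h = "pair (proj1 C B (Cod C f) \<cdot> b) a"
  show "\<exists>!h. h \<in> hom C X (Dom C (proj2 C B (Dom C f))) \<and> proj2 C B (Dom C f) \<cdot> h = a \<and>
      prod_map C (Id C B) f \<cdot> h = b"
  proof (rule ex1I[of _ ?h])
    have "prod_map C (Id C B) f \<cdot> ?h = b"
      by (rule prod_ext[of _ _ B "Cod C f"]) (use ab assms in simp_all)
    then show "?h \<in> hom C X (Dom C (proj2 C B (Dom C f))) \<and> proj2 C B (Dom C f) \<cdot> ?h = a \<and>
        prod_map C (Id C B) f \<cdot> ?h = b"
      using ab assms by (simp del: prod_map_eq)
  next
    fix h
    assume "h \<in> hom C X (Dom C (proj2 C B (Dom C f))) \<and> proj2 C B (Dom C f) \<cdot> h = a \<and>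
        prod_map C (Id C B) f \<cdot> h = b"
    then have h: "h \<in> hom C X (Dom C (proj2 C B (Dom C f)))"
      and ha: "proj2 C B (Dom C f) \<cdot> h = a" and hb: "prod_map C (Id C B) f \<cdot> h = b"
      by - (elim conjE; assumption)+
    have "proj1 C B (Dom C f) \<cdot> h = proj1 C B (Cod C f) \<cdot> prod_map C (Id C B) f \<cdot> h"
      using h assms by simp
    also have "\<dots> = proj1 C B (Cod C f) \<cdot> b" by (simp only: hb)
    finally show "h = ?h"
      using h ha ab(1,2) assms by - (rule prod_ext[of _ _ B "Dom C f"], simp_all)
  qed
qed (use assms in simp_all)

lemma factors_prod_map_iff:
  assumes f: "f \<in> Mor C" "g \<in> Mor C" and x: "x \<in> Mor C" "Cod C x = prod_obj C (Cod C f) (Cod C g)"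
  shows "x \<sqsubseteq> prod_map C f g \<longleftrightarrow>
    proj1 C (Cod C f) (Cod C g) \<cdot> x \<sqsubseteq> f \<and> proj2 C (Cod C f) (Cod C g) \<cdot> x \<sqsubseteq> g"
proof
  assume "x \<sqsubseteq> prod_map C f g"
  then obtain h where h: "h \<in> Mor C" "Cod C h = Dom C (prod_map C f g)" "prod_map C f g \<cdot> h = x"
    by (rule factorsE)
  have "f \<cdot> proj1 C (Dom C f) (Dom C g) \<cdot> h = proj1 C (Cod C f) (Cod C g) \<cdot> x"
    "g \<cdot> proj2 C (Dom C f) (Dom C g) \<cdot> h = proj2 C (Cod C f) (Cod C g) \<cdot> x"
    using h f by (auto simp flip: h(3))
  then show "proj1 C (Cod C f) (Cod C g) \<cdot> x \<sqsubseteq> f \<and> proj2 C (Cod C f) (Cod C g) \<cdot> x \<sqsubseteq> g"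
    using h(1,2) f x
    by (intro conjI factorsI[of f "proj1 C (Dom C f) (Dom C g) \<cdot> h"]
        factorsI[of g "proj2 C (Dom C f) (Dom C g) \<cdot> h"]) simp_all
next
  assume R: "proj1 C (Cod C f) (Cod C g) \<cdot> x \<sqsubseteq> f \<and> proj2 C (Cod C f) (Cod C g) \<cdot> x \<sqsubseteq> g"
  obtain a where a: "a \<in> Mor C" "Dom C a = Dom C x" "Cod C a = Dom C f"
    "f \<cdot> a = proj1 C (Cod C f) (Cod C g) \<cdot> x"
    using conjunct1[OF R] f x by (auto elim: factorsE)
  obtain b where b: "b \<in> Mor C" "Dom C b = Dom C x" "Cod C b = Dom C g"
    "g \<cdot> b = proj2 C (Cod C f) (Cod C g) \<cdot> x"
    using conjunct2[OF R] f x by (auto elim: factorsE)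
  have "prod_map C f g \<cdot> pair a b = x"
    by (rule prod_ext[of _ _ "Cod C f" "Cod C g"]) (use a b f x in simp_all)
  then show "x \<sqsubseteq> prod_map C f g"
    using a b f by (intro factorsI[of _ "pair a b"]) simp_all
qed

lemma prod_map_Mono:
  assumes "f \<in> Mono C" "g \<in> Mono C"
  shows "prod_map C f g \<in> Mono C"
proof (rule MonoI)
  show "prod_map C f g \<in> Mor C" using assms by simp
  fix x y
  assume xy: "x \<in> Mor C" "y \<in> Mor C" "Dom C x = Dom C y" "Cod C x = Dom C (prod_map C f g)"
    "Cod C y = Dom C (prod_map C f g)" "prod_map C f g \<cdot> x = prod_map C f g \<cdot> y"
  let ?p = "proj1 C (Dom C f) (Dom C g)" and ?q = "proj2 C (Dom C f) (Dom C g)"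
  have "proj1 C (Cod C f) (Cod C g) \<cdot> prod_map C f g \<cdot> x =
      proj1 C (Cod C f) (Cod C g) \<cdot> prod_map C f g \<cdot> y"
    "proj2 C (Cod C f) (Cod C g) \<cdot> prod_map C f g \<cdot> x =
      proj2 C (Cod C f) (Cod C g) \<cdot> prod_map C f g \<cdot> y"
    by (simp_all only: xy(6))
  then have "f \<cdot> ?p \<cdot> x = f \<cdot> ?p \<cdot> y" "g \<cdot> ?q \<cdot> x = g \<cdot> ?q \<cdot> y"
    using xy(1-5) assms by simp_all
  then have "?p \<cdot> x = ?p \<cdot> y" "?q \<cdot> x = ?q \<cdot> y"
    using xy(1-5) assms
    by - (rule Mono_cancel[OF assms(1)], simp_all, rule Mono_cancel[OF assms(2)], simp_all)
  then show "x = y"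
    using xy(1-5) assms by - (rule prod_ext[of _ _ "Dom C f" "Dom C g"], simp_all)
qed

end

section \<open>Stable factorizations and the induced topology\<close>

context elementary_topos
begin

lemma factors_tr_iff:
  assumes "x \<in> Mor C" "Cod C x = \<Omega>"
  shows "x \<sqsubseteq> tr \<longleftrightarrow> x = true (Dom C x)"
proof
  assume "x \<sqsubseteq> tr"
  then obtain h where h: "h \<in> Mor C" "Dom C h = Dom C x" "Cod C h = one" "tr \<cdot> h = x"
    by (rule factorsE)
  have "tr \<cdot> h = true (Dom C x)" using h(1-3) by simp
  then show "x = true (Dom C x)" by (simp only: h(4))
next
  assume x: "x = true (Dom C x)"
  show "x \<sqsubseteq> tr"
    by (rule factorsI[of tr "bang (Dom C x)"])
      (use assms in \<open>simp_all add: true_def[symmetric] x[symmetric] del: tr_Comp\<close>)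
qed

end

section \<open>Consequences of the axioms of a double factorization system\<close>

lemma is_dfs_ex1:
  assumes "is_dfs C \<E> \<J> \<M>"
    and "e \<in> \<E>" "e \<in> hom C A B" "j \<in> \<J>" "j \<in> hom C B D"
    and "j' \<in> \<J>" "j' \<in> hom C A' B'" "m \<in> \<M>" "m \<in> hom C B' D'"
    and "u \<in> hom C A A'" "v \<in> hom C D D'"
    and "v \<cdot>\<^bsub>C\<^esub> j \<cdot>\<^bsub>C\<^esub> e = m \<cdot>\<^bsub>C\<^esub> j' \<cdot>\<^bsub>C\<^esub> u"
  shows "\<exists>!st. case st of (s, t) \<Rightarrow> s \<in> hom C B A' \<and> t \<in> hom C D B' \<and>
    s \<cdot>\<^bsub>C\<^esub> e = u \<and> j' \<cdot>\<^bsub>C\<^esub> s = t \<cdot>\<^bsub>C\<^esub> j \<and> m \<cdot>\<^bsub>C\<^esub> t = v"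
proof -
  have "\<forall>A B D A' B' D' e j j' m u v.
    e \<in> \<E> \<and> e \<in> hom C A B \<and> j \<in> \<J> \<and> j \<in> hom C B D \<and>
    j' \<in> \<J> \<and> j' \<in> hom C A' B' \<and> m \<in> \<M> \<and> m \<in> hom C B' D' \<and>
    u \<in> hom C A A' \<and> v \<in> hom C D D' \<and>
    v \<cdot>\<^bsub>C\<^esub> j \<cdot>\<^bsub>C\<^esub> e = m \<cdot>\<^bsub>C\<^esub> j' \<cdot>\<^bsub>C\<^esub> u \<longrightarrow>
    (\<exists>!st. case st of (s, t) \<Rightarrow> s \<in> hom C B A' \<and> t \<in> hom C D B' \<and>
      s \<cdot>\<^bsub>C\<^esub> e = u \<and> j' \<cdot>\<^bsub>C\<^esub> s = t \<cdot>\<^bsub>C\<^esub> j \<and> m \<cdot>\<^bsub>C\<^esub> t = v)"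
    using assms(1) unfolding is_dfs_def by (elim conjE)
  from this[rule_format, of e A B j D j' A' B' m D' u v] show ?thesis
    using assms(2-) by blast
qed

lemma is_dfsD:
  assumes "is_dfs C \<E> \<J> \<M>"
  shows "\<E> \<subseteq> Mor C" "\<J> \<subseteq> Mor C" "\<M> \<subseteq> Mor C"
    "Iso C \<bullet>\<^bsub>C\<^esub> \<E> \<subseteq> \<E>" "Iso C \<bullet>\<^bsub>C\<^esub> \<J> \<bullet>\<^bsub>C\<^esub> Iso C \<subseteq> \<J>" "\<M> \<bullet>\<^bsub>C\<^esub> Iso C \<subseteq> \<M>"
    "Mor C \<subseteq> \<M> \<bullet>\<^bsub>C\<^esub> \<J> \<bullet>\<^bsub>C\<^esub> \<E>"
  using assms unfolding is_dfs_def by - (elim conjE; assumption)+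

context category
begin

lemma is_dfs_factorization:
  assumes dfs: "is_dfs C \<E> \<J> \<M>" and "f \<in> Mor C"
  obtains m j e where "m \<in> \<M>" "j \<in> \<J>" "e \<in> \<E>" "Dom C m = Cod C j" "Dom C j = Cod C e"
    "m \<in> Mor C" "j \<in> Mor C" "e \<in> Mor C" "f = m \<cdot> j \<cdot> e"
proof -
  note D = is_dfsD[OF dfs]
  obtain m l where m: "m \<in> \<M>" "l \<in> \<J> \<bullet> \<E>" "Dom C m = Cod C l" "f = m \<cdot> l"
    using subsetD[OF D(7) assms(2)] by (rule class_compE)
  obtain j e where je: "j \<in> \<J>" "e \<in> \<E>" "Dom C j = Cod C e" "l = j \<cdot> e"
    using m(2) by (rule class_compE)
  have "m \<in> Mor C" "j \<in> Mor C" "e \<in> Mor C" using m(1) je(1,2) D(1-3) by auto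
  then show thesis using m je by (intro that[of m j e]) simp_all
qed

text \<open>If \<open>m \<cdot> j \<cdot> e\<close> is an identity, then the square from \<open>m \<cdot> j \<cdot> e\<close> to itself has the two
  fillers \<open>(1, 1)\<close> and \<open>(e \<cdot> m \<cdot> j, j \<cdot> e \<cdot> m)\<close>, so all three factors are invertible.\<close>

lemma is_dfs_Id:
  assumes dfs: "is_dfs C \<E> \<J> \<M>" and A: "A \<in> Obj C"
  shows "Id C A \<in> \<E>" "Id C A \<in> \<J>" "Id C A \<in> \<M>"
proof -
  note D = is_dfsD[OF dfs]
  obtain m j e where in_cls: "m \<in> \<M>" "j \<in> \<J>" "e \<in> \<E>"
    and dc: "Dom C m = Cod C j" "Dom C j = Cod C e"
    and mor: "m \<in> Mor C" "j \<in> Mor C" "e \<in> Mor C" and mje: "Id C A = m \<cdot> j \<cdot> e"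
    using is_dfs_factorization[OF dfs, of "Id C A"] A by auto
  have "Dom C (Id C A) = Dom C (m \<cdot> j \<cdot> e)" "Cod C (Id C A) = Cod C (m \<cdot> j \<cdot> e)"
    by (simp_all only: mje)
  then have e: "Dom C e = A" and m: "Cod C m = A" using A dc mor by simp_all
  let ?B = "Cod C e" and ?D = "Cod C j"
  have id1: "(m \<cdot> j) \<cdot> e = Id C A" "m \<cdot> j \<cdot> e = Id C A" using mje mor dc by simp_all
  have ex1: "\<exists>!st. case st of (s, t) \<Rightarrow> s \<in> hom C ?B ?B \<and> t \<in> hom C ?D ?D \<and>
      s \<cdot> e = e \<and> j \<cdot> s = t \<cdot> j \<and> m \<cdot> t = m"
    by (rule is_dfs_ex1[OF dfs, of e A ?B j ?D j ?B ?D m A]) (use in_cls mor dc e m in simp_all)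
  have "(e \<cdot> m \<cdot> j) \<cdot> e = e \<cdot> ((m \<cdot> j) \<cdot> e)" "m \<cdot> j \<cdot> e \<cdot> m = ((m \<cdot> j) \<cdot> e) \<cdot> m"
    using mor dc e m by simp_all
  then have "(e \<cdot> m \<cdot> j) \<cdot> e = e" "m \<cdot> j \<cdot> e \<cdot> m = m"
    unfolding id1 using mor e m by simp_all
  then have fill: "case (e \<cdot> m \<cdot> j, j \<cdot> e \<cdot> m) of (s, t) \<Rightarrow> s \<in> hom C ?B ?B \<and> t \<in> hom C ?D ?D \<and>
      s \<cdot> e = e \<and> j \<cdot> s = t \<cdot> j \<and> m \<cdot> t = m"
    using mor dc e m by simp
  have "case (Id C ?B, Id C ?D) of (s, t) \<Rightarrow> s \<in> hom C ?B ?B \<and> t \<in> hom C ?D ?D \<and>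
      s \<cdot> e = e \<and> j \<cdot> s = t \<cdot> j \<and> m \<cdot> t = m"
    using mor dc by simp
  with fill have "(e \<cdot> m \<cdot> j, j \<cdot> e \<cdot> m) = (Id C ?B, Id C ?D)"
    using ex1 by blast
  then have id2: "e \<cdot> m \<cdot> j = Id C ?B" "(j \<cdot> e) \<cdot> m = Id C ?D" using mor dc e m by simp_all
  have iso: "m \<in> Iso C" "j \<cdot> e \<in> Iso C" "e \<in> Iso C" "m \<cdot> j \<in> Iso C"
    by (rule IsoI[of m "j \<cdot> e"] IsoI[of "j \<cdot> e" m] IsoI[of e "m \<cdot> j"] IsoI[of "m \<cdot> j" e];
        use mor dc e m id1 id2 in simp)+
  \<comment> \<open>The identity is now a single factor \<open>e\<close>, \<open>j\<close> or
    \<open>m\<close> composed with isomorphisms on exactly the sides that the closure condition of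
    its class permits.\<close>
  have "(m \<cdot> j) \<cdot> e \<in> \<E>"
    using D(4) class_compI[OF in_cls(3) iso(4)] mor dc by auto
  then show "Id C A \<in> \<E>" by (simp only: id1)
  have "m \<cdot> j \<cdot> e \<in> \<J>"
    using D(5) class_compI[OF class_compI[OF iso(3) in_cls(2)] iso(1)] mor dc by auto
  then show "Id C A \<in> \<J>" by (simp only: id1)
  have "m \<cdot> j \<cdot> e \<in> \<M>"
    using D(6) class_compI[OF iso(2) in_cls(1)] mor dc by auto
  then show "Id C A \<in> \<M>" by (simp only: id1)
qed

text \<open>A square from \<open>j \<cdot> e\<close> to \<open>n\<close> is a double square whose
  second middle arrow is an identity, which lies in \<open>\<J>\<close>. The component
  \<open>t\<close> of its filler is the diagonal.\<close>

lemma is_dfs_lift: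
  assumes dfs: "is_dfs C \<E> \<J> \<M>" and l: "l \<in> \<J> \<bullet> \<E>" and n: "n \<in> \<M>"
    and v: "v \<in> Mor C" "Dom C v = Cod C l" and vl: "v \<cdot> l \<sqsubseteq> n"
  shows "v \<sqsubseteq> n"
proof -
  note D = is_dfsD[OF dfs]
  obtain j e where je: "j \<in> \<J>" "e \<in> \<E>" "Dom C j = Cod C e" "l = j \<cdot> e"
    using l by (rule class_compE)
  have mor: "j \<in> Mor C" "e \<in> Mor C" "n \<in> Mor C" using je n D(1-3) by auto
  obtain u where u: "u \<in> Mor C" "Dom C u = Dom C (v \<cdot> l)" "Cod C u = Dom C n" "n \<cdot> u = v \<cdot> l"
    "Cod C (v \<cdot> l) = Cod C n"
    using vl by (rule factorsE)
  have dv: "Dom C v = Cod C j" and du: "Dom C u = Dom C e" and cv: "Cod C v = Cod C n"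
    using v u(2,5) je(3,4) mor by simp_all
  have eq: "v \<cdot> j \<cdot> e = n \<cdot> Id C (Dom C n) \<cdot> u" using u(1,3,4) je(4) mor by simp
  have "\<exists>!st. case st of (s, t) \<Rightarrow> s \<in> hom C (Cod C e) (Dom C n) \<and> t \<in> hom C (Cod C j) (Dom C n) \<and>
      s \<cdot> e = u \<and> Id C (Dom C n) \<cdot> s = t \<cdot> j \<and> n \<cdot> t = v"
    by (rule is_dfs_ex1[OF dfs _ _ _ _ _ _ _ _ _ _ eq])
      (use is_dfs_Id[OF dfs, of "Dom C n"] n je(1-3) mor dv du cv u(1,3) v in simp_all)
  then obtain t where "t \<in> hom C (Cod C j) (Dom C n)" "n \<cdot> t = v" by blast
  then show ?thesis using mor by (intro factorsI[of n t]) simp_all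
qed

end

section \<open>Stable orthogonal factorization with a monic right class\<close>

text \<open>Models \<open>L = \<J> \<bullet> \<E>\<close> and \<open>M = \<M>\<close>. The axiom
  \<open>lift\<close> hides the top side of the square inside \<open>\<sqsubseteq>\<close> and asks
  only for existence of a diagonal, because \<open>M_Mono\<close> yields its uniqueness.\<close>

locale stable_factorization =
  elementary_topos C tr for C :: "('o, 'm, 'z) category_scheme" (structure) and tr +
  fixes L M :: "'m set"
  assumes L_Mor: "L \<subseteq> Mor C"
    and M_Mono: "M \<subseteq> Mono C"
    and Iso_L: "Iso C \<bullet> L \<subseteq> L"
    and M_Iso: "M \<bullet> Iso C \<subseteq> M"
    and factorization: "Mor C \<subseteq> M \<bullet> L"
    and lift: "l \<in> L \<Longrightarrow> n \<in> M \<Longrightarrow> v \<in> Mor C \<Longrightarrow> Dom C v = Cod C l \<Longrightarrow> v \<cdot> l \<sqsubseteq> n \<Longrightarrow> v \<sqsubseteq> n"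
    and stable: "pullback_stable C L"
begin

lemma L_in_Mor [simp]: "l \<in> L \<Longrightarrow> l \<in> Mor C"
  using L_Mor by blast

lemma M_in_Mono [simp]: "n \<in> M \<Longrightarrow> n \<in> Mono C"
  using M_Mono by blast

lemma factorize:
  assumes "f \<in> Mor C"
  obtains n l where "n \<in> M" "l \<in> L" "Dom C n = Cod C l" "f = n \<cdot> l"
  by (rule class_compE[OF subsetD[OF factorization assms]]) (rule that)

text \<open>The criterion for membership in \<open>L\<close>: the last hypothesis makes the
  monomorphism \<open>n\<close> invertible, and \<open>Iso_L\<close> absorbs it.\<close>

lemma split_M_L:
  assumes "n \<in> M" "l \<in> L" "Dom C n = Cod C l" "Id C (Cod C n) \<sqsubseteq> n"
  shows "n \<cdot> l \<in> L"
  using Iso_L class_compI[OF assms(2) Mono_split_Iso[OF M_in_Mono[OF assms(1)] assms(4)] assms(3)]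
  by blast

lemma Id_L:
  assumes "A \<in> Obj C"
  shows "Id C A \<in> L"
proof -
  obtain n l where nl: "n \<in> M" "l \<in> L" "Dom C n = Cod C l" "Id C A = n \<cdot> l"
    using factorize[of "Id C A"] assms by auto
  have "Cod C n = Cod C (Id C A)" unfolding nl(4) using nl(1-3) by simp
  then have cod: "Cod C n = A" using assms by simp
  have "n \<cdot> l \<in> L"
  proof (rule split_M_L[OF nl(1-3)])
    show "Id C (Cod C n) \<sqsubseteq> n"
      unfolding cod nl(4) using nl(1-3) by (intro factorsI[of n l]) simp_all
  qed
  then show ?thesis by (simp only: nl(4))
qed

text \<open>With \<open>tr = n\<^sub>0 \<cdot> l\<^sub>0\<close>, the pullback of \<open>n\<^sub>0\<close> along the characteristic morphism of a
  monomorphism \<open>n \<cdot> l\<close> is \<open>n\<close>.\<close>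

lemma char_mor_factors_iff:
  assumes tr: "n\<^sub>0 \<in> M" "l\<^sub>0 \<in> L" "Dom C n\<^sub>0 = Cod C l\<^sub>0" "tr = n\<^sub>0 \<cdot> l\<^sub>0"
    and nl: "n \<in> M" "l \<in> L" "Dom C n = Cod C l" "n \<cdot> l \<in> Mono C"
    and x: "x \<in> Mor C" "Cod C x = Cod C n"
  shows "char_mor C tr (n \<cdot> l) \<cdot> x \<sqsubseteq> n\<^sub>0 \<longleftrightarrow> x \<sqsubseteq> n"
proof -
  let ?m = "n \<cdot> l" and ?\<chi> = "char_mor C tr (n \<cdot> l)"
  let ?b = "bang (Dom C ?m)"
  have n0: "Cod C n\<^sub>0 = \<Omega>" "Dom C l\<^sub>0 = one" unfolding tr(4) using tr(1-3) by simp_all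
  have chi: "?\<chi> \<in> Mor C" "Dom C ?\<chi> = Cod C n" "Cod C ?\<chi> = \<Omega>" using nl by simp_all
  have b: "?b \<in> Mor C" "Dom C ?b = Dom C l" "Cod C ?b = one" using nl by simp_all
  have m: "Dom C ?m = Dom C l" "Cod C ?m = Cod C n" using nl by simp_all
  have "?\<chi> \<cdot> ?m = true (Dom C ?m)"
    using char_mor_true_iff[OF nl(4), of ?m] factors_refl[of ?m] nl(4) by simp
  also have "\<dots> = (n\<^sub>0 \<cdot> l\<^sub>0) \<cdot> ?b" by (simp only: true_def tr(4)[symmetric])
  also have "\<dots> = n\<^sub>0 \<cdot> l\<^sub>0 \<cdot> ?b" using tr(1-3) n0 b by simp
  finally have chi_m: "?\<chi> \<cdot> ?m = n\<^sub>0 \<cdot> l\<^sub>0 \<cdot> ?b" .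
  show ?thesis
  proof
    assume "x \<sqsubseteq> n"
    then obtain y where y: "y \<in> Mor C" "Cod C y = Dom C n" "n \<cdot> y = x" by (rule factorsE)
    have "(?\<chi> \<cdot> n) \<cdot> l = n\<^sub>0 \<cdot> l\<^sub>0 \<cdot> ?b" unfolding chi_m[symmetric] using chi nl by simp
    then have "(?\<chi> \<cdot> n) \<cdot> l \<sqsubseteq> n\<^sub>0"
      using tr(1-3) n0 b by (intro factorsI[of n\<^sub>0 "l\<^sub>0 \<cdot> ?b"]) simp_all
    then have "?\<chi> \<cdot> n \<sqsubseteq> n\<^sub>0"
      by (rule lift[OF nl(2) tr(1), rotated -1]) (use chi nl in simp_all)
    then have "(?\<chi> \<cdot> n) \<cdot> y \<sqsubseteq> n\<^sub>0"
      by (rule factors_Comp) (use y(1,2) chi nl in simp_all)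
    then have "?\<chi> \<cdot> n \<cdot> y \<sqsubseteq> n\<^sub>0" using y(1,2) chi nl(1) by simp
    then show "?\<chi> \<cdot> x \<sqsubseteq> n\<^sub>0" by (simp only: y(3))
  next
    assume "?\<chi> \<cdot> x \<sqsubseteq> n\<^sub>0"
    then obtain y where y: "y \<in> Mor C" "Dom C y = Dom C (?\<chi> \<cdot> x)" "Cod C y = Dom C n\<^sub>0"
      "n\<^sub>0 \<cdot> y = ?\<chi> \<cdot> x"
      by (rule factorsE)
    have dy: "Dom C x = Dom C y" using y(2) x chi by simp
    \<comment> \<open>\<open>p\<close> is the closure of \<open>n \<cdot> l\<close> computed as a
      pullback. Since \<open>x \<sqsubseteq> p\<close>, it remains to show
      \<open>p \<sqsubseteq> n\<close>, for which the comparison \<open>l\<^sub>1\<close> from the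
      domain of \<open>n \<cdot> l\<close> to that of \<open>p\<close> must lie in
      \<open>L\<close>.\<close>
    obtain p q where pb: "is_pullback C ?\<chi> n\<^sub>0 p q"
      using pullbacks[of ?\<chi> n\<^sub>0] chi tr(1) n0 by auto
    note P = is_pullbackD[OF pb]
    obtain h where "h \<in> Mor C" "Cod C h = Dom C p" "p \<cdot> h = x"
      by (rule is_pullback_lift[OF pb x(1) y(1) dy _ y(3) y(4)[symmetric]]) (use x chi in simp_all)
    then have xp: "x \<sqsubseteq> p" using P(4) by (intro factorsI)
    obtain l\<^sub>1 where l1: "l\<^sub>1 \<in> Mor C" "Dom C l\<^sub>1 = Dom C l" "Cod C l\<^sub>1 = Dom C p"
      "p \<cdot> l\<^sub>1 = ?m" "q \<cdot> l\<^sub>1 = l\<^sub>0 \<cdot> ?b"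
      by (rule is_pullback_lift[OF pb _ _ _ _ _ chi_m]) (use nl(1-3) tr(1-3) n0 b chi m in simp_all)
    \<comment> \<open>Pullback cancellation: pasted with the square of \<open>p\<close>, this square
      gives the one that pulls \<open>tr = n\<^sub>0 \<cdot> l\<^sub>0\<close> back to
      \<open>n \<cdot> l\<close>. Hence \<open>l\<^sub>1\<close> is a pullback of
      \<open>l\<^sub>0\<close>, and stability applies.\<close>
    have "is_pullback C l\<^sub>0 q ?b l\<^sub>1"
      unfolding is_pullback_def
    proof (intro conjI allI ballI impI)
      fix X a c
      assume a: "a \<in> hom C X (Dom C l\<^sub>0)" and c: "c \<in> hom C X (Dom C q)" and ac: "l\<^sub>0 \<cdot> a = q \<cdot> c"
      have "?\<chi> \<cdot> p \<cdot> c = n\<^sub>0 \<cdot> q \<cdot> c"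
        by (rule Comp_eq_extend[OF P(9)]) (use P(1-8) c in simp_all)
      also have "\<dots> = n\<^sub>0 \<cdot> l\<^sub>0 \<cdot> a" by (simp only: ac)
      also have "\<dots> = (n\<^sub>0 \<cdot> l\<^sub>0) \<cdot> a" using tr(1-3) a by simp
      also have "\<dots> = tr \<cdot> a" by (simp only: tr(4)[symmetric])
      also have "\<dots> = true (Dom C (p \<cdot> c))" using a c n0 P by simp
      finally have "p \<cdot> c \<sqsubseteq> ?m"
        by (rule char_mor_true_iff[OF nl(4), THEN iffD1, rotated -1]) (use P c m chi in simp_all)
      then obtain h where h: "h \<in> Mor C" "Dom C h = Dom C (p \<cdot> c)" "Cod C h = Dom C ?m"
        "?m \<cdot> h = p \<cdot> c"
        by (rule factorsE)
      have hX: "Dom C h = X" "Cod C h = Dom C l" using h(2,3) P c m by simp_all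
      have pM: "p \<in> Mono C" using is_pullback_Mono[OF pb] tr(1) by simp
      have "p \<cdot> l\<^sub>1 \<cdot> h = ?m \<cdot> h"
        by (rule Comp_extend[OF l1(4)]) (use l1(1-3) P(4) h(1) hX in simp_all)
      also have "\<dots> = p \<cdot> c" by (rule h(4))
      finally have "l\<^sub>1 \<cdot> h = c"
        by (rule Mono_cancel[OF pM]) (use l1(1-3) P(4,6,7) c h(1) hX in simp_all)
      moreover have "?b \<cdot> h = a"
        by (rule to_one_eq) (use b h(1) hX a n0 in simp_all)
      ultimately have "h \<in> hom C X (Dom C ?b) \<and> ?b \<cdot> h = a \<and> l\<^sub>1 \<cdot> h = c"
        using h(1) hX b by simp
      then show "\<exists>!h. h \<in> hom C X (Dom C ?b) \<and> ?b \<cdot> h = a \<and> l\<^sub>1 \<cdot> h = c"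
      proof (rule ex1I)
        fix h'
        assume "h' \<in> hom C X (Dom C ?b) \<and> ?b \<cdot> h' = a \<and> l\<^sub>1 \<cdot> h' = c"
        then have h'C: "h' \<in> hom C X (Dom C ?b)" and l1h': "l\<^sub>1 \<cdot> h' = c" by - (elim conjE; assumption)+
        have h': "h' \<in> Mor C" "Dom C h' = X" "Cod C h' = Dom C l" using h'C b by simp_all
        have "?m \<cdot> h' = p \<cdot> l\<^sub>1 \<cdot> h'"
          by (rule Comp_extend[OF l1(4), symmetric]) (use l1(1-3) P(4) h' in simp_all)
        also have "\<dots> = ?m \<cdot> h" by (simp only: l1h' h(4))
        finally show "h' = h"
          by (rule Mono_cancel[OF nl(4)]) (use h' h(1) hX m in simp_all)
      qed
    qed (use l1 b P n0 tr(2,3) in simp_all)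
    then have "l\<^sub>1 \<in> L" using stable tr(2) unfolding pullback_stable_def by blast
    moreover have "p \<cdot> l\<^sub>1 \<sqsubseteq> n"
      unfolding l1(4) using nl(1-3) by (intro factorsI[of n l]) simp_all
    ultimately have "p \<sqsubseteq> n" using lift[OF _ nl(1) P(4), of l\<^sub>1] l1(3) by simp
    with xp show "x \<sqsubseteq> n" by (rule factors_trans)
  qed
qed

text \<open>One direction lifts both projections of \<open>n\<close> against
  \<open>n\<^sub>0\<close>. The other lifts \<open>n\<^sub>0\<close> x \<open>n\<^sub>0\<close>
  against \<open>n\<close>. This is the content of compatibility with conjunction.\<close>

lemma M_part_of_prod_map_tr:
  assumes tr: "n\<^sub>0 \<in> M" "l\<^sub>0 \<in> L" "Dom C n\<^sub>0 = Cod C l\<^sub>0" "tr = n\<^sub>0 \<cdot> l\<^sub>0"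
    and nl: "n \<in> M" "l \<in> L" "Dom C n = Cod C l" "prod_map C tr tr = n \<cdot> l"
  shows "n \<sqsubseteq> prod_map C n\<^sub>0 n\<^sub>0" "prod_map C n\<^sub>0 n\<^sub>0 \<sqsubseteq> n"
proof -
  have n0: "Cod C n\<^sub>0 = \<Omega>" "Dom C l\<^sub>0 = one" unfolding tr(4) using tr(1-3) by simp_all
  have "Cod C n = Cod C (prod_map C tr tr)" "Dom C l = Dom C (prod_map C tr tr)"
    unfolding nl(4) using nl(1-3) by simp_all
  then have n: "Cod C n = prod_obj C \<Omega> \<Omega>" "Dom C l = prod_obj C one one" by simp_all
  have nm: "n \<in> Mor C" "n\<^sub>0 \<in> Mor C" "l\<^sub>0 \<in> Mor C" "l \<in> Mor C" using nl tr by simp_all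
  have tr_n0: "tr \<sqsubseteq> n\<^sub>0"
    by (rule factorsI[of n\<^sub>0 l\<^sub>0]) (use tr(1-3) in \<open>simp_all add: tr(4)[symmetric]\<close>)
  have "(proj1 C \<Omega> \<Omega> \<cdot> n) \<cdot> l = proj1 C \<Omega> \<Omega> \<cdot> prod_map C tr tr"
    "(proj2 C \<Omega> \<Omega> \<cdot> n) \<cdot> l = proj2 C \<Omega> \<Omega> \<cdot> prod_map C tr tr"
    unfolding nl(4) using nm n nl(3) by simp_all
  moreover have "proj1 C \<Omega> \<Omega> \<cdot> prod_map C tr tr = tr \<cdot> proj1 C one one"
    "proj2 C \<Omega> \<Omega> \<cdot> prod_map C tr tr = tr \<cdot> proj2 C one one"
    by simp_all
  moreover have "tr \<cdot> proj1 C one one \<sqsubseteq> n\<^sub>0" "tr \<cdot> proj2 C one one \<sqsubseteq> n\<^sub>0"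
    using tr_n0 by (simp_all add: factors_Comp del: tr_Comp)
  ultimately have pn: "(proj1 C \<Omega> \<Omega> \<cdot> n) \<cdot> l \<sqsubseteq> n\<^sub>0" "(proj2 C \<Omega> \<Omega> \<cdot> n) \<cdot> l \<sqsubseteq> n\<^sub>0"
    by (simp_all only:)
  have "proj1 C \<Omega> \<Omega> \<cdot> n \<sqsubseteq> n\<^sub>0"
    by (rule lift[OF nl(2) tr(1) _ _ pn(1)]) (use nm n nl(3) in simp_all)
  moreover have "proj2 C \<Omega> \<Omega> \<cdot> n \<sqsubseteq> n\<^sub>0"
    by (rule lift[OF nl(2) tr(1) _ _ pn(2)]) (use nm n nl(3) in simp_all)
  ultimately show "n \<sqsubseteq> prod_map C n\<^sub>0 n\<^sub>0"
    using factors_prod_map_iff[of n\<^sub>0 n\<^sub>0 n] nm n n0 by (simp del: prod_map_eq)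
  \<comment> \<open>\<open>l\<^sub>0\<close> x \<open>l\<^sub>0\<close> is split into two pullbacks
    of \<open>l\<^sub>0\<close>, each in \<open>L\<close> by stability. Lifting along one after the
    other spares an argument that \<open>L\<close> is closed under composition.\<close>
  let ?l1 = "prod_map C (Id C one) l\<^sub>0" and ?l2 = "prod_map C l\<^sub>0 (Id C (Dom C n\<^sub>0))"
  let ?n2 = "prod_map C n\<^sub>0 n\<^sub>0"
  have l12: "?l1 \<in> L" "?l2 \<in> L"
    using stable tr(2) pullback_prod_map_right[OF nm(3), of one]
      pullback_prod_map_left[OF nm(3), of "Dom C n\<^sub>0"] nm(2)
    unfolding pullback_stable_def by (blast intro: Dom_in_Obj tr_Mor)+
  have "(?n2 \<cdot> ?l2) \<cdot> ?l1 = prod_map C (n\<^sub>0 \<cdot> l\<^sub>0) (n\<^sub>0 \<cdot> l\<^sub>0)"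
    using nm n0 tr(3) by simp
  also have "\<dots> = n \<cdot> l" by (simp only: tr(4)[symmetric] nl(4))
  finally have "(?n2 \<cdot> ?l2) \<cdot> ?l1 \<sqsubseteq> n"
    using nm nl(3) by (intro factorsI[of n l]) (simp_all del: prod_map_eq)
  then have "?n2 \<cdot> ?l2 \<sqsubseteq> n"
    by (rule lift[OF l12(1) nl(1), rotated -1]) (use nm n0 tr(3) in simp_all)
  then show "?n2 \<sqsubseteq> n"
    by (rule lift[OF l12(2) nl(1), rotated -1]) (use nm n0 tr(3) in simp_all)
qed

text \<open>\<open>k\<close> classifies \<open>n\<^sub>0\<close>, so \<open>k \<cdot> x\<close> is
  true exactly when \<open>x \<sqsubseteq> n\<^sub>0\<close>. By \<open>char_mor_factors_iff\<close>
  the closure of \<open>n \<cdot> l\<close> then has the same generalized elements as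
  \<open>n\<close>.\<close>

lemma generated_topology:
  obtains k where "lawvere_tierney C tr k"
    and "\<And>n l. n \<in> M \<Longrightarrow> l \<in> L \<Longrightarrow> Dom C n = Cod C l \<Longrightarrow> n \<cdot> l \<in> Mono C \<Longrightarrow>
      subobj_equiv C (closure_op C tr k (n \<cdot> l)) n"
proof -
  obtain n\<^sub>0 l\<^sub>0 where tr: "n\<^sub>0 \<in> M" "l\<^sub>0 \<in> L" "Dom C n\<^sub>0 = Cod C l\<^sub>0" "tr = n\<^sub>0 \<cdot> l\<^sub>0"
    by (rule factorize[OF tr_Mor])
  have n0: "Cod C n\<^sub>0 = \<Omega>" "n\<^sub>0 \<in> Mono C" unfolding tr(4) using tr(1-3) by simp_all
  define k where "k = char_mor C tr n\<^sub>0"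
  have k: "k \<in> Mor C" "Dom C k = \<Omega>" "Cod C k = \<Omega>" using n0 by (simp_all add: k_def)
  have k_true: "k \<cdot> x = true (Dom C x) \<longleftrightarrow> x \<sqsubseteq> n\<^sub>0" if "x \<in> Mor C" "Cod C x = \<Omega>" for x
    unfolding k_def using char_mor_true_iff[OF n0(2), of x] that n0(1) by simp
  have k_char: "k \<cdot> char_mor C tr (n \<cdot> l) \<cdot> x = true (Dom C x) \<longleftrightarrow> x \<sqsubseteq> n"
    if nl: "n \<in> M" "l \<in> L" "Dom C n = Cod C l" "n \<cdot> l \<in> Mono C" and x: "x \<in> Mor C" "Cod C x = Cod C n"
    for n l x
  proof -
    let ?\<chi> = "char_mor C tr (n \<cdot> l)"
    have "?\<chi> \<cdot> x \<in> Mor C" "Cod C (?\<chi> \<cdot> x) = \<Omega>" "Dom C (?\<chi> \<cdot> x) = Dom C x"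
      using nl x by simp_all
    then show ?thesis
      using k_true[of "?\<chi> \<cdot> x"] char_mor_factors_iff[OF tr nl x] by simp
  qed
  show thesis
  proof (rule that[of k])
    have k_tr: "k \<cdot> tr = tr"
    proof -
      have "tr \<sqsubseteq> n\<^sub>0"
        by (rule factorsI[of n\<^sub>0 l\<^sub>0]) (use tr(1-3) in \<open>simp_all add: tr(4)[symmetric]\<close>)
      then have "k \<cdot> tr = true one" using k_true[of tr] by simp
      then show ?thesis by (simp only: tr_eq_true[symmetric])
    qed
    have k_k: "k \<cdot> k = k"
    proof (rule Omega_ext)
      fix x
      assume "x \<in> Mor C" "Cod C x = Dom C (k \<cdot> k)"
      then have x: "x \<in> Mor C" "Cod C x = \<Omega>" using k by simp_all
      \<comment> \<open>Factoring \<open>n\<^sub>0\<close> with an identity as its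
        \<open>L\<close>-part shows that closing \<open>n\<^sub>0\<close> again changes
        nothing.\<close>
      have "n\<^sub>0 \<cdot> Id C (Dom C n\<^sub>0) = n\<^sub>0" using n0 by simp
      then have "k \<cdot> k \<cdot> x = true (Dom C x) \<longleftrightarrow> x \<sqsubseteq> n\<^sub>0"
        using k_char[OF tr(1) Id_L, of "Dom C n\<^sub>0" x] n0 x by (simp add: k_def)
      then show "(k \<cdot> k) \<cdot> x = true (Dom C x) \<longleftrightarrow> k \<cdot> x = true (Dom C x)"
        using k_true[OF x] x k by simp
    qed (use k in simp_all)
    have k_conj: "k \<cdot> conj_mor C tr = conj_mor C tr \<cdot> prod_map C k k"
    proof -
      let ?m = "prod_map C tr tr" and ?c = "conj_mor C tr"
      have m: "?m \<in> Mono C" by (rule prod_map_Mono[OF tr_Mono tr_Mono])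
      have cm: "Cod C ?m = prod_obj C \<Omega> \<Omega>" by simp
      have c: "?c \<in> Mor C" "Dom C ?c = prod_obj C \<Omega> \<Omega>" "Cod C ?c = \<Omega>"
        unfolding conj_mor_def using char_mor_simps[OF m] cm by simp_all
      obtain n l where nl: "n \<in> M" "l \<in> L" "Dom C n = Cod C l" "?m = n \<cdot> l"
        by (rule factorize[OF Mono_Mor[OF m]])
      have "Cod C n = Cod C (n \<cdot> l)" using nl(1-3) by simp
      then have cn: "Cod C n = prod_obj C \<Omega> \<Omega>" by (simp only: nl(4)[symmetric] cm)
      \<comment> \<open>Both sides of the conjunction law reduce to this condition: on the left
        \<open>k\<close> closes \<open>tr\<close> x \<open>tr\<close>, on the right \<open>k\<close>
        is applied to each component before both are tested for truth.\<close>
      have n_iff: "x \<sqsubseteq> n \<longleftrightarrow> x \<sqsubseteq> prod_map C n\<^sub>0 n\<^sub>0" for x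
        using M_part_of_prod_map_tr[OF tr nl] factors_trans by blast
      show ?thesis
      proof (rule Omega_ext)
        fix x
        assume "x \<in> Mor C" "Cod C x = Dom C (k \<cdot> ?c)"
        then have x: "x \<in> Mor C" "Cod C x = prod_obj C \<Omega> \<Omega>" using k c by simp_all
        let ?a = "proj1 C \<Omega> \<Omega> \<cdot> x" and ?b = "proj2 C \<Omega> \<Omega> \<cdot> x" and ?y = "prod_map C k k \<cdot> x"
        have ab: "?a \<in> Mor C" "Cod C ?a = \<Omega>" "Dom C ?a = Dom C x"
          "?b \<in> Mor C" "Cod C ?b = \<Omega>" "Dom C ?b = Dom C x"
          using x by simp_all
        have y: "?y \<in> Mor C" "Cod C ?y = prod_obj C \<Omega> \<Omega>" "Dom C ?y = Dom C x"
          "proj1 C \<Omega> \<Omega> \<cdot> ?y = k \<cdot> ?a" "proj2 C \<Omega> \<Omega> \<cdot> ?y = k \<cdot> ?b"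
          using x k by simp_all
        have "k \<cdot> ?c \<cdot> x = true (Dom C x) \<longleftrightarrow> x \<sqsubseteq> n"
          using k_char[OF nl(1-3), of x] m x cn unfolding conj_mor_def nl(4) by simp
        also have "\<dots> \<longleftrightarrow> ?a \<sqsubseteq> n\<^sub>0 \<and> ?b \<sqsubseteq> n\<^sub>0"
          unfolding n_iff using factors_prod_map_iff[of n\<^sub>0 n\<^sub>0 x] n0 x by (simp del: prod_map_eq)
        also have "\<dots> \<longleftrightarrow> k \<cdot> ?a = true (Dom C x) \<and> k \<cdot> ?b = true (Dom C x)"
          using k_true[OF ab(1,2)] k_true[OF ab(4,5)] by (simp only: ab)
        also have "\<dots> \<longleftrightarrow> proj1 C \<Omega> \<Omega> \<cdot> ?y \<sqsubseteq> tr \<and> proj2 C \<Omega> \<Omega> \<cdot> ?y \<sqsubseteq> tr"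
          unfolding y(4,5) using factors_tr_iff[of "k \<cdot> ?a"] factors_tr_iff[of "k \<cdot> ?b"] k ab
          by simp
        also have "\<dots> \<longleftrightarrow> ?y \<sqsubseteq> ?m"
          using factors_prod_map_iff[OF tr_Mor tr_Mor y(1,2)] by (simp only:)
        also have "\<dots> \<longleftrightarrow> ?c \<cdot> ?y = true (Dom C x)"
          unfolding conj_mor_def using char_mor_true_iff[OF m y(1)] y(2,3) cm by (simp only:)
        finally show "(k \<cdot> ?c) \<cdot> x = true (Dom C x) \<longleftrightarrow> (?c \<cdot> prod_map C k k) \<cdot> x = true (Dom C x)"
          using x k c by simp
      qed (use k c in simp_all)
    qed
    show "lawvere_tierney C tr k"
      unfolding lawvere_tierney_def using k k_tr k_k k_conj by simp
  next
    fix n l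
    assume nl: "n \<in> M" "l \<in> L" "Dom C n = Cod C l" "n \<cdot> l \<in> Mono C"
    let ?c = "closure_op C tr k (n \<cdot> l)"
    note c = closure_op_simps[OF nl(4) k]
    have cod: "Cod C (n \<cdot> l) = Cod C n" using nl by simp
    have iff: "x \<sqsubseteq> ?c \<longleftrightarrow> x \<sqsubseteq> n" if "x \<in> Mor C" "Cod C x = Cod C n" for x
      using c(3)[of x] k_char[OF nl that] that cod by simp
    have "?c \<sqsubseteq> n" "n \<sqsubseteq> ?c"
      using iff[of ?c] iff[of n] c(1,2) nl(1) cod factors_refl[of ?c] factors_refl[of n] by simp_all
    then show "subobj_equiv C ?c n" using c(1) nl(1) by (simp add: subobj_equiv_iff)
  qed
qed

end

section \<open>Dense and closed monomorphisms of the generated topology\<close>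

text \<open>Records the property of \<open>k\<close> on which the comparison of the two systems
  rests: closure is passage to the \<open>M\<close>-part.\<close>

locale generated_closure = stable_factorization +
  fixes k
  assumes closure_equiv: "n \<in> M \<Longrightarrow> l \<in> L \<Longrightarrow> Dom C n = Cod C l \<Longrightarrow> n \<cdot> l \<in> Mono C \<Longrightarrow>
      subobj_equiv C (closure_op C tr k (n \<cdot> l)) n"
begin

lemma closure_equiv_iff:
  assumes "n \<in> M" "l \<in> L" "Dom C n = Cod C l" "n \<cdot> l \<in> Mono C"
  shows "subobj_equiv C (closure_op C tr k (n \<cdot> l)) p \<longleftrightarrow> subobj_equiv C p n"
  using closure_equiv[OF assms] factors_trans unfolding subobj_equiv_iff by blast

text \<open>\<open>m = n \<cdot> l\<close> is dense iff the identity factors through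
  \<open>n\<close>. This gives \<open>m \<in> L\<close> by \<open>split_M_L\<close>; conversely, for
  \<open>m \<in> L\<close> the identity is a lift of \<open>m\<close> against
  \<open>n\<close>.\<close>

lemma DnsMono_eq: "DnsMono C tr k = L \<inter> Mono C"
proof -
  have "subobj_equiv C (closure_op C tr k m) (Id C (Cod C m)) \<longleftrightarrow> m \<in> L" if m: "m \<in> Mono C" for m
  proof -
    obtain n l where nl: "n \<in> M" "l \<in> L" "Dom C n = Cod C l" "m = n \<cdot> l"
      by (rule factorize[OF Mono_Mor[OF m]])
    have "Cod C (n \<cdot> l) = Cod C n" using nl by simp
    then have cod: "Cod C n = Cod C m" by (simp only: nl(4))
    have "n \<sqsubseteq> Id C (Cod C n)" using nl(1) by (intro factorsI[of _ n]) simp_all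
    then have "subobj_equiv C (closure_op C tr k m) (Id C (Cod C n)) \<longleftrightarrow> Id C (Cod C n) \<sqsubseteq> n"
      unfolding nl(4) closure_equiv_iff[OF nl(1-3) m[unfolded nl(4)]]
      using nl(1) by (simp add: Iso_Mono subobj_equiv_iff)
    also have "\<dots> \<longleftrightarrow> m \<in> L"
    proof
      assume "Id C (Cod C n) \<sqsubseteq> n"
      then show "m \<in> L" unfolding nl(4) using nl(1-3) by (intro split_M_L)
    next
      assume mL: "m \<in> L"
      have "m \<sqsubseteq> n" unfolding nl(4) using nl(1-3) by (intro factorsI[of n l]) simp_all
      then have "Id C (Cod C n) \<cdot> m \<sqsubseteq> n" using m cod by simp
      then show "Id C (Cod C n) \<sqsubseteq> n"
        by (rule lift[OF mL nl(1), rotated -1]) (use nl(1) cod m in simp_all)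
    qed
    finally show ?thesis by (simp only: cod)
  qed
  then show ?thesis unfolding DnsMono_def by blast
qed

text \<open>A closed monomorphism is isomorphic to its \<open>M\<close>-part, and \<open>M\<close>
  absorbs isomorphisms. A member of \<open>M\<close> is its own \<open>M\<close>-part, with an
  identity as \<open>L\<close>-part.\<close>

lemma ClsMono_eq: "ClsMono C tr k = M"
proof (intro equalityI subsetI)
  fix m
  assume "m \<in> ClsMono C tr k"
  then have m: "m \<in> Mono C" and cm: "subobj_equiv C (closure_op C tr k m) m"
    by (simp_all add: ClsMono_def)
  obtain n l where nl: "n \<in> M" "l \<in> L" "Dom C n = Cod C l" "m = n \<cdot> l"
    by (rule factorize[OF Mono_Mor[OF m]])
  have "subobj_equiv C m n"
    using cm closure_equiv_iff[OF nl(1-3), of m] m unfolding nl(4) by blast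
  then obtain i where "i \<in> Iso C" "i \<in> hom C (Dom C m) (Dom C n)" "n \<cdot> i = m"
    unfolding subobj_equiv_def by (elim conjE bexE)
  then show "m \<in> M"
    using M_Iso class_compI[of i "Iso C" n M] nl(1) by auto
next
  fix m
  assume m: "m \<in> M"
  then have "m \<cdot> Id C (Dom C m) = m" by simp
  then have "subobj_equiv C (closure_op C tr k m) m"
    using closure_equiv[OF m Id_L[of "Dom C m"]] m by simp
  then show "m \<in> ClsMono C tr k" using m by (simp add: ClsMono_def)
qed

text \<open>Each inclusion shows that an \<open>M\<close>-part \<open>n\<close> is split. For
  \<open>m \<cdot> e\<close>, \<open>Epi_lift\<close> removes \<open>e\<close> and then
  \<open>m \<in> L\<close> lifts the identity; for \<open>f \<in> L\<close> with image
  \<open>i\<close>, the \<open>M\<close>-part of \<open>i\<close> contains \<open>f\<close>, so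
  \<open>f\<close> itself lifts the identity.\<close>

lemma L_Mono_Epi_eq: "(L \<inter> Mono C) \<bullet> Epi C = L"
proof (intro equalityI subsetI)
  fix f
  assume "f \<in> (L \<inter> Mono C) \<bullet> Epi C"
  then obtain e m where em: "e \<in> Epi C" "m \<in> L \<inter> Mono C" "Dom C m = Cod C e" "f = m \<cdot> e"
    by (rule class_compE)
  have f: "f \<in> Mor C" "Cod C f = Cod C m" unfolding em(4) using em(1-3) by simp_all
  obtain n l where nl: "n \<in> M" "l \<in> L" "Dom C n = Cod C l" "f = n \<cdot> l"
    by (rule factorize[OF f(1)])
  have cod: "Cod C m = Cod C n" unfolding f(2)[symmetric] nl(4) using nl(1-3) by simp
  have "f \<sqsubseteq> n" unfolding nl(4) using nl(1-3) by (intro factorsI[of n l]) simp_all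
  then have "m \<sqsubseteq> n"
    unfolding em(4) using em(1-3) nl(1) by - (rule Epi_lift[of e], simp_all)
  then have "Id C (Cod C n) \<cdot> m \<sqsubseteq> n" using em(2) cod by simp
  then have "Id C (Cod C n) \<sqsubseteq> n"
    by (rule lift[OF _ nl(1), rotated -1]) (use em(2) nl(1) cod in simp_all)
  then show "f \<in> L" unfolding nl(4) by (rule split_M_L[OF nl(1-3)])
next
  fix f
  assume f: "f \<in> L"
  obtain i e where ie: "i \<in> Mono C" "e \<in> Epi C" "Dom C i = Cod C e" "f = i \<cdot> e"
    by (rule epi_mono_factorization[OF L_in_Mor[OF f]])
  have fi: "Cod C f = Cod C i" unfolding ie(4) using ie(1-3) by simp
  obtain n l where nl: "n \<in> M" "l \<in> L" "Dom C n = Cod C l" "i = n \<cdot> l"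
    by (rule factorize[OF Mono_Mor[OF ie(1)]])
  have cod: "Cod C i = Cod C n" "Dom C i = Dom C l" unfolding nl(4) using nl(1-3) by simp_all
  have "i \<sqsubseteq> n" unfolding nl(4) using nl(1-3) by (intro factorsI[of n l]) simp_all
  then have "i \<cdot> e \<sqsubseteq> n" by (rule factors_Comp) (use ie(2,3) in simp_all)
  then have "Id C (Cod C n) \<cdot> f \<sqsubseteq> n"
    using f fi cod ie(4)[symmetric] by simp
  then have "Id C (Cod C n) \<sqsubseteq> n"
    by (rule lift[OF f nl(1), rotated -1]) (use nl(1) fi cod in simp_all)
  then have "i \<in> L" unfolding nl(4) by (rule split_M_L[OF nl(1-3)])
  then show "f \<in> (L \<inter> Mono C) \<bullet> Epi C"
    unfolding ie(4) using ie(1-3) by (intro class_compI) simp_all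
qed

text \<open>The filler comes from two separate lifts: \<open>s\<close> from the epimorphism
  \<open>e\<close> against the monomorphism \<open>m \<cdot> j'\<close>, and \<open>t\<close> from
  \<open>j \<in> L\<close> against \<open>m \<in> M\<close>. Compatibility and uniqueness follow by
  cancelling \<open>m \<cdot> j'\<close>, \<open>m\<close> and \<open>e\<close>.\<close>

lemma is_dfs_Epi_Dns_Cls: "is_dfs C (Epi C) (DnsMono C tr k) (ClsMono C tr k)"
  unfolding DnsMono_eq ClsMono_eq is_dfs_def
proof (intro conjI allI impI)
  show "Iso C \<bullet> Epi C \<subseteq> Epi C"
    by (auto elim!: class_compE intro: Epi_Comp Iso_Epi)
  show "Iso C \<bullet> (L \<inter> Mono C) \<bullet> Iso C \<subseteq> L \<inter> Mono C"
  proof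
    fix f
    assume "f \<in> Iso C \<bullet> (L \<inter> Mono C) \<bullet> Iso C"
    then obtain g b where b: "g \<in> (L \<inter> Mono C) \<bullet> Iso C" "b \<in> Iso C" "Dom C b = Cod C g" "f = b \<cdot> g"
      by (rule class_compE)
    obtain a m where a: "a \<in> Iso C" "m \<in> L \<inter> Mono C" "Dom C m = Cod C a" "g = m \<cdot> a"
      using b(1) by (rule class_compE)
    \<comment> \<open>\<open>Iso_L\<close> absorbs isomorphisms on the left only; on the right they
      are treated as epimorphisms.\<close>
    have "g \<in> (L \<inter> Mono C) \<bullet> Epi C"
      unfolding a(4) using a(1-3) by (intro class_compI Iso_Epi) simp_all
    then have "g \<in> L" by (simp only: L_Mono_Epi_eq)
    then have "f \<in> L" unfolding b(4) using Iso_L class_compI[of g L b "Iso C"] b(2,3) by auto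
    moreover have "g \<in> Mono C" unfolding a(4) using a(2,3) by (intro Mono_Comp Iso_Mono[OF a(1)]) simp_all
    then have "f \<in> Mono C" unfolding b(4) using b(3) by (intro Mono_Comp Iso_Mono[OF b(2)]) simp_all
    ultimately show "f \<in> L \<inter> Mono C" by simp
  qed
  show "Mor C \<subseteq> M \<bullet> (L \<inter> Mono C) \<bullet> Epi C"
    unfolding L_Mono_Epi_eq by (rule factorization)
  fix A B D A' B' D' e j j' m u v
  assume H: "e \<in> Epi C \<and> e \<in> hom C A B \<and> j \<in> L \<inter> Mono C \<and> j \<in> hom C B D \<and>
    j' \<in> L \<inter> Mono C \<and> j' \<in> hom C A' B' \<and> m \<in> M \<and> m \<in> hom C B' D' \<and>
    u \<in> hom C A A' \<and> v \<in> hom C D D' \<and> v \<cdot> j \<cdot> e = m \<cdot> j' \<cdot> u"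
  then have eq: "v \<cdot> j \<cdot> e = m \<cdot> j' \<cdot> u" by (elim conjE)
  have e: "e \<in> Epi C" "e \<in> Mor C" "Dom C e = A" "Cod C e = B"
    and j: "j \<in> L" "j \<in> Mor C" "Dom C j = B" "Cod C j = D"
    and j': "j' \<in> Mono C" "j' \<in> Mor C" "Dom C j' = A'" "Cod C j' = B'"
    and m: "m \<in> M" "m \<in> Mor C" "m \<in> Mono C" "Dom C m = B'" "Cod C m = D'"
    and u: "u \<in> Mor C" "Dom C u = A" "Cod C u = A'"
    and v: "v \<in> Mor C" "Dom C v = D" "Cod C v = D'"
    using H[THEN conjunct1] H[THEN conjunct2] unfolding hom_iff
    by - ((elim conjE)?, (assumption | simp))+
  have mj': "m \<cdot> j' \<in> Mono C" using m(3,4) j'(1,4) by (intro Mono_Comp) simp_all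
  have "(v \<cdot> j) \<cdot> e = (m \<cdot> j') \<cdot> u" using eq e(2-) j(2-) j'(2-) m(2,4,5) u v by simp
  then have "(v \<cdot> j) \<cdot> e \<sqsubseteq> m \<cdot> j'"
    using j'(2-) m(2,4,5) u by (intro factorsI[of _ u]) simp_all
  then have vj: "v \<cdot> j \<sqsubseteq> m \<cdot> j'"
    by (rule Epi_lift[OF e(1) mj', rotated -1]) (use e j(2-) v in simp_all)
  then obtain s where s: "s \<in> Mor C" "Dom C s = Dom C (v \<cdot> j)" "Cod C s = Dom C (m \<cdot> j')"
    "(m \<cdot> j') \<cdot> s = v \<cdot> j"
    by (rule factorsE)
  have s': "s \<in> Mor C" "Dom C s = B" "Cod C s = A'" using s(1-3) v j(2-) j'(2-) m(2,4,5) by simp_all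
  have mjs: "m \<cdot> j' \<cdot> s = v \<cdot> j" unfolding s(4)[symmetric] using s' j'(2-) m(2,4,5) by simp
  have "m \<cdot> j' \<sqsubseteq> m" by (rule factorsI[of m j']) (use j'(2-) m(2,4,5) in simp_all)
  with vj have "v \<cdot> j \<sqsubseteq> m" by (rule factors_trans)
  then have "v \<sqsubseteq> m" by (rule lift[OF j(1) m(1), rotated -1]) (use v j in simp_all)
  then obtain t where t: "t \<in> Mor C" "Dom C t = Dom C v" "Cod C t = Dom C m" "m \<cdot> t = v"
    by (rule factorsE)
  have t': "t \<in> Mor C" "Dom C t = D" "Cod C t = B'" using t(1-3) v m(4) by simp_all
  have "(m \<cdot> j') \<cdot> s \<cdot> e = ((m \<cdot> j') \<cdot> s) \<cdot> e"
    using s' e(2-) j'(2-) m(2,4,5) by simp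
  also have "\<dots> = (m \<cdot> j') \<cdot> u"
    unfolding s(4) using eq e(2-) j(2-) j'(2-) m(2,4,5) u v by simp
  finally have se: "s \<cdot> e = u"
    by (rule Mono_cancel[OF mj']) (use s' e(2-) u j'(2-) m(2,4,5) in simp_all)
  have "m \<cdot> t \<cdot> j = v \<cdot> j" by (rule Comp_extend[OF t(4)]) (use t' j(2-) m(2,4) in simp_all)
  with mjs have "m \<cdot> j' \<cdot> s = m \<cdot> t \<cdot> j" by (simp only:)
  then have js: "j' \<cdot> s = t \<cdot> j"
    by (rule Mono_cancel[OF m(3)]) (use s' t' j(2-) j'(2-) m(4) in simp_all)
  show "\<exists>!st. case st of (s, t) \<Rightarrow> s \<in> hom C B A' \<and> t \<in> hom C D B' \<and>
      s \<cdot> e = u \<and> j' \<cdot> s = t \<cdot> j \<and> m \<cdot> t = v"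
  proof (rule ex1I[of _ "(s, t)"])
    show "case (s, t) of (s, t) \<Rightarrow> s \<in> hom C B A' \<and> t \<in> hom C D B' \<and>
        s \<cdot> e = u \<and> j' \<cdot> s = t \<cdot> j \<and> m \<cdot> t = v"
      using s' t' se js t(4) by (simp only: prod.case hom_iff simp_thms)
  next
    fix st
    assume "case st of (s, t) \<Rightarrow> s \<in> hom C B A' \<and> t \<in> hom C D B' \<and>
        s \<cdot> e = u \<and> j' \<cdot> s = t \<cdot> j \<and> m \<cdot> t = v"
    then obtain s2 t2 where st: "st = (s2, t2)"
      and 2: "s2 \<in> hom C B A'" "t2 \<in> hom C D B'" "s2 \<cdot> e = u" "m \<cdot> t2 = v"
      by (cases st) blast
    have "s2 \<cdot> e = s \<cdot> e" "m \<cdot> t2 = m \<cdot> t" by (simp_all only: 2(3,4) se t(4))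
    then have "s2 = s" "t2 = t"
      using Epi_cancel[OF e(1), of s2 s] Mono_cancel[OF m(3), of t2 t] 2(1,2) s' t' e(4) m(4)
      by simp_all
    then show "st = (s, t)" using st by simp
  qed
qed (use L_Mor M_Mono M_Iso in \<open>auto\<close>)

end

section \<open>Cartesian double factorization systems\<close>

context elementary_topos
begin

lemma cartesian_dfs_stable_factorization:
  assumes cart: "cartesian_dfs C \<E> \<J> \<M>"
  shows "stable_factorization C tr (\<J> \<bullet> \<E>) \<M>"
proof
  have dfs: "is_dfs C \<E> \<J> \<M>" and st: "pullback_stable C (\<J> \<bullet> \<E>)"
    and mono: "\<M> \<bullet> \<J> \<subseteq> Mono C"
    using cart by (simp_all add: cartesian_dfs_def)
  note D = is_dfsD[OF dfs]
  show "\<J> \<bullet> \<E> \<subseteq> Mor C" using D(1,2) by (auto elim!: class_compE simp: subset_iff)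
  show "\<M> \<subseteq> Mono C"
  proof
    fix m
    assume m: "m \<in> \<M>"
    then have "m \<in> Mor C" using D(3) by blast
    \<comment> \<open>Identities lie in \<open>\<J>\<close>, so the assumption on
      \<open>\<M> \<bullet> \<J>\<close> reaches \<open>m\<close> alone.\<close>
    then have "m \<cdot> Id C (Dom C m) \<in> \<M> \<bullet> \<J>"
      using is_dfs_Id(2)[OF dfs, of "Dom C m"] m by (intro class_compI) simp_all
    then show "m \<in> Mono C" using mono \<open>m \<in> Mor C\<close> by auto
  qed
  show "Iso C \<bullet> \<J> \<bullet> \<E> \<subseteq> \<J> \<bullet> \<E>"
  proof
    fix f
    assume "f \<in> Iso C \<bullet> \<J> \<bullet> \<E>"
    then obtain l i where i: "l \<in> \<J> \<bullet> \<E>" "i \<in> Iso C" "Dom C i = Cod C l" "f = i \<cdot> l"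
      by (rule class_compE)
    obtain e j where je: "e \<in> \<E>" "j \<in> \<J>" "Dom C j = Cod C e" "l = j \<cdot> e"
      using i(1) by (rule class_compE)
    have mor: "e \<in> Mor C" "j \<in> Mor C" "i \<in> Mor C" using je(1,2) i(2) D(1,2) by auto
    have dom: "Dom C i = Cod C j" using i(3) je(3,4) mor by simp
    \<comment> \<open>The closure condition on \<open>\<J>\<close> is two-sided, so an identity is
      inserted on the right.\<close>
    have "i \<cdot> j \<cdot> Id C (Dom C j) \<in> \<J>"
      using D(5) class_compI[OF class_compI[OF Id_Iso je(2)] i(2), of "Dom C j"] mor dom by auto
    then have "i \<cdot> j \<in> \<J>" using mor by simp
    then have "(i \<cdot> j) \<cdot> e \<in> \<J> \<bullet> \<E>" using je mor dom by (intro class_compI) simp_all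
    then show "f \<in> \<J> \<bullet> \<E>" unfolding i(4) je(4) using mor je(3) dom by simp
  qed
  show "\<M> \<bullet> Iso C \<subseteq> \<M>" by (rule D)
  show "Mor C \<subseteq> \<M> \<bullet> \<J> \<bullet> \<E>" by (rule D)
  show "pullback_stable C (\<J> \<bullet> \<E>)" by (rule st)
  fix l n v
  assume "l \<in> \<J> \<bullet> \<E>" "n \<in> \<M>" "v \<in> Mor C" "Dom C v = Cod C l" "v \<cdot> l \<sqsubseteq> n"
  then show "v \<sqsubseteq> n" by (rule is_dfs_lift[OF dfs])
qed

text \<open>An epimorphism factors through its own monic part \<open>m \<cdot> j\<close>, so
  \<open>Epi_lift\<close> splits that part. It is then invertible, and \<open>\<E>\<close> absorbs
  it.\<close>

lemma cartesian_dfs_Epi: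
  assumes cart: "cartesian_dfs C \<E> \<J> \<M>"
  shows "Epi C \<subseteq> \<E>"
proof
  fix f
  assume f: "f \<in> Epi C"
  have dfs: "is_dfs C \<E> \<J> \<M>" and mono: "\<M> \<bullet> \<J> \<subseteq> Mono C"
    using cart by (simp_all add: cartesian_dfs_def)
  note D = is_dfsD[OF dfs]
  obtain m j e where mje: "m \<in> \<M>" "j \<in> \<J>" "e \<in> \<E>" "Dom C m = Cod C j" "Dom C j = Cod C e"
    "m \<in> Mor C" "j \<in> Mor C" "e \<in> Mor C" "f = m \<cdot> j \<cdot> e"
    by (rule is_dfs_factorization[OF dfs Epi_Mor[OF f]])
  have mj: "m \<cdot> j \<in> Mono C" using mono class_compI[OF mje(2,1,4)] by blast
  have feq: "f = (m \<cdot> j) \<cdot> e" unfolding mje(9) using mje(4-8) by simp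
  have cod: "Cod C f = Cod C (m \<cdot> j)" unfolding feq using mje(4-8) by simp
  have "f \<sqsubseteq> m \<cdot> j" unfolding feq using mje(4-8) by (intro factorsI[of _ e]) simp_all
  then have "Id C (Cod C (m \<cdot> j)) \<sqsubseteq> m \<cdot> j"
    using f cod mj by - (rule Epi_lift[OF f mj], simp_all)
  then have "m \<cdot> j \<in> Iso C" by (rule Mono_split_Iso[OF mj])
  then have "(m \<cdot> j) \<cdot> e \<in> Iso C \<bullet> \<E>" using mje(3-8) by (intro class_compI) simp_all
  then show "f \<in> \<E>" unfolding feq using D(4) by blast
qed

end

theorem proposition3:
  fixes C :: "('o, 'm) category" and tr :: 'm and \<E> \<J> \<M> :: "'m set"
  assumes "elementary_topos C tr"
    and "cartesian_dfs C \<E> \<J> \<M>"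
  shows "\<exists>k. generates_topology C tr \<E> \<J> \<M> k \<and>
    bousfield_localization C (\<E>, \<J>, \<M>) (Epi C, DnsMono C tr k, ClsMono C tr k)"
proof -
  interpret elementary_topos C tr by (rule assms(1))
  interpret stable_factorization C tr "\<J> \<bullet>\<^bsub>C\<^esub> \<E>" \<M>
    by (rule cartesian_dfs_stable_factorization[OF assms(2)])
  obtain k where k: "lawvere_tierney C tr k"
    and closure: "\<And>n l. n \<in> \<M> \<Longrightarrow> l \<in> \<J> \<bullet>\<^bsub>C\<^esub> \<E> \<Longrightarrow> Dom C n = Cod C l \<Longrightarrow> n \<cdot>\<^bsub>C\<^esub> l \<in> Mono C \<Longrightarrow>
      subobj_equiv C (closure_op C tr k (n \<cdot>\<^bsub>C\<^esub> l)) n"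
    by (rule generated_topology) blast
  interpret generated_closure C tr "\<J> \<bullet>\<^bsub>C\<^esub> \<E>" \<M> k
    by unfold_locales (rule closure)
  have dfs: "is_dfs C \<E> \<J> \<M>" using assms(2) by (simp add: cartesian_dfs_def)
  note D = is_dfsD[OF dfs]
  have "generates_topology C tr \<E> \<J> \<M> k"
    unfolding generates_topology_def
  proof (intro conjI ballI impI k)
    fix e j n
    assume mem: "e \<in> \<E>" "j \<in> \<J>" "n \<in> \<M>"
      and H: "Cod C e = Dom C j \<and> Cod C j = Dom C n \<and> n \<cdot>\<^bsub>C\<^esub> j \<cdot>\<^bsub>C\<^esub> e \<in> Mono C"
    have "e \<in> Mor C" "j \<in> Mor C" using mem D(1,2) by auto
    with mem H show "subobj_equiv C (closure_op C tr k (n \<cdot>\<^bsub>C\<^esub> j \<cdot>\<^bsub>C\<^esub> e)) n"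
      by (intro closure class_compI) simp_all
  qed
  \<comment> \<open>The closed monomorphisms are exactly \<open>\<M>\<close>, so the inclusion of
    composites reduces to \<open>Epi C \<subseteq> \<E>\<close>.\<close>
  moreover have "ClsMono C tr k \<bullet>\<^bsub>C\<^esub> Epi C \<subseteq> \<M> \<bullet>\<^bsub>C\<^esub> \<E>"
    unfolding ClsMono_eq using cartesian_dfs_Epi[OF assms(2)] by (auto simp: class_comp_def)
  moreover have "DnsMono C tr k \<bullet>\<^bsub>C\<^esub> Epi C = \<J> \<bullet>\<^bsub>C\<^esub> \<E>"
    unfolding DnsMono_eq by (rule L_Mono_Epi_eq)
  ultimately show ?thesis
    using is_dfs_Epi_Dns_Cls dfs unfolding bousfield_localization_def by auto
qed

end
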